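(* The following graph isomorphisms hold. (a) For $n\ge 3$ and $D_{2n}=\langle a,b: a^n=b^2=1,\ bab^{-1}=a^{-1}\rangle$: $\mathrm{ESCom}(D_{2n})\cong K_1\vee(nK_1\sqcup K_{n-1})$ if $n$ is odd, and $\mathrm{ESCom}(D_{2n})\cong K_2\vee(\frac n2K_2\sqcup K_{n-2})$ if $n$ is even. (b) For $n\ge 2$ and $Q_{4n}=\langle a,b: a^{2n}=1,\ a^n=b^2,\ bab^{-1}=a^{-1}\rangle$: $\mathrm{ESCom}(Q_{4n})\cong K_2\vee(nK_2\sqcup K_{2n-2})$. (c) For $n\ge 4$ and $QD_{2^n}=\langle a,b: a^{2^{n-1}}=b^2=1,\ bab^{-1}=a^{2^{n-2}-1}\rangle$: $\mathrm{ESCom}(QD_{2^n})\cong K_2\vee(K_{2^{n-1}-2}\sqcup 2^{n-2}K_2)$. (d) For $n\ge 1$ and $V_{8n}=\langle a,b: a^{2n}=b^4=1,\ ba=a^{-1}b^{-1},\ b^{-1}a=a^{-1}b\rangle$: $\mathrm{ESCom}(V_{8n})\cong K_2\vee(K_{4n-2}\sqcup 2nK_2)$ if $n$ is odd, and $\mathrm{ESCom}(V_{8n})\cong K_4\vee(K_{4n-4}\sqcup nK_4)$ if $n$ is even. (e) For $n\ge 2$ and $SD_{8n}=\langle a,b: a^{4n}=b^2=1,\ bab^{-1}=a^{2n-1}\rangle$: $\mathrm{ESCom}(SD_{8n})\cong K_4\vee(K_{4n-4}\sqcup nK_4)$ if $n$ is odd, and $\mathrm{ESCom}(SD_{8n})\cong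 K_2\vee(K_{4n-2}\sqcup 2nK_2)$ if $n$ is even. (f) For $n\ge 1$ and $U_{6n}=\langle a,b: a^{2n}=b^3=1,\ a^{-1}ba=b^{-1}\rangle$: $\mathrm{ESCom}(U_{6n})\cong K_n\vee(K_{2n}\sqcup 3K_n)$. (g) For $m\ge 3$ with $m\ne 4$, $n\ge 1$, and $M_{2mn}=\langle a,b: a^m=b^{2n}=1,\ bab^{-1}=a^{-1}\rangle$: $\mathrm{ESCom}(M_{2mn})\cong K_n\vee(K_{(m-1)n}\sqcup mK_n)$ if $m$ is odd, and $\mathrm{ESCom}(M_{2mn})\cong K_{2n}\vee(K_{(\frac m2-1)2n}\sqcup\frac m2K_{2n})$ if $m$ is even.
   Context: For a finite group $G$, the equality super commuting graph $\mathrm{ESCom}(G)$ is the simple graph with vertex set $G$ in which two distinct vertices $g,h$ are adjacent if and only if $gh=hg$ (i.e. the commuting graph on all of $G$). $K_r$ is the complete graph on $r$ vertices, $\sqcup$ is disjoint union of graphs, $sK_r$ is the disjoint union of $s$ copies of $K_r$, and $\vee$ is the join of graphs (disjoint union together with all edges between the two vertex sets). All parameters are integers. *)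

theory Defs
  imports "HOL-Algebra.Group" "Graph_Theory.Digraph_Isomorphism" "Graph_Theory.Kuratowski"
begin

section \<open>Groups given by presentations\<close>

datatype 'g letter = Pos 'g | Neg 'g

type_synonym 'g word = "'g letter list"

fun letter_inv :: "'g letter \<Rightarrow> 'g letter" where
  "letter_inv (Pos g) = Neg g"
| "letter_inv (Neg g) = Pos g"

definition word_inv :: "'g word \<Rightarrow> 'g word" where
  "word_inv w = rev (map letter_inv w)"

definition word_pow :: "'g word \<Rightarrow> nat \<Rightarrow> 'g word" where
  "word_pow w k = concat (replicate k w)"

text \<open>
  A pair \<open>(l, r)\<close> in \<open>R\<close> stands for the relation \<open>l = r\<close>. The relation below is the
  least congruence on words that contains \<open>R\<close> and makes \<open>Neg g\<close> a two-sided inverse of \<open>Pos g\<close>;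
  its classes are the elements of the free group modulo the normal closure of the relators.
\<close>

inductive pres_eq :: "('g word \<times> 'g word) set \<Rightarrow> 'g word \<Rightarrow> 'g word \<Rightarrow> bool"
  for R where
  refl: "pres_eq R u u"
| sym: "pres_eq R u v \<Longrightarrow> pres_eq R v u"
| trans: "pres_eq R u v \<Longrightarrow> pres_eq R v w \<Longrightarrow> pres_eq R u w"
| cancel: "pres_eq R (u @ [x, letter_inv x] @ v) (u @ v)"
| rel: "(l, r) \<in> R \<Longrightarrow> pres_eq R (u @ l @ v) (u @ r @ v)"

definition pres_rel :: "('g word \<times> 'g word) set \<Rightarrow> ('g word \<times> 'g word) set" where
  "pres_rel R = {(u, v). pres_eq R u v}"

definition presented_group :: "('g word \<times> 'g word) set \<Rightarrow> 'g word set monoid" where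
  "presented_group R =
     \<lparr> carrier = UNIV // pres_rel R,
       monoid.mult = (\<lambda>X Y. \<Union>u\<in>X. \<Union>v\<in>Y. pres_rel R `` {u @ v}),
       one = pres_rel R `` {[]} \<rparr>"

lemma equiv_pres_rel: "equiv UNIV (pres_rel R)"
proof (rule equivI)
  show "pres_rel R \<subseteq> UNIV \<times> UNIV"
    by simp
  show "refl (pres_rel R)"
    by (rule refl_onI) (simp_all add: pres_rel_def pres_eq.refl)
  show "sym (pres_rel R)"
    by (rule symI) (simp add: pres_rel_def pres_eq.sym)
  show "trans (pres_rel R)"
    by (rule transI) (simp add: pres_rel_def, rule pres_eq.trans)
qed

lemma pres_eq_context:
  assumes "pres_eq R u v" shows "pres_eq R (p @ u @ q) (p @ v @ q)"
  using assms
proof (induction rule: pres_eq.induct)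
  case (cancel u x v)
  show ?case using pres_eq.cancel[of R "p @ u" x "v @ q"] by simp
next
  case (rel l r u v)
  then show ?case using pres_eq.rel[of l r R "p @ u" "v @ q"] by simp
qed (rule pres_eq.refl, erule pres_eq.sym, erule (1) pres_eq.trans)

lemma pres_eq_append:
  assumes "pres_eq R u u'" "pres_eq R v v'" shows "pres_eq R (u @ v) (u' @ v')"
proof (rule pres_eq.trans)
  show "pres_eq R (u @ v) (u' @ v)"
    using pres_eq_context[OF assms(1), of "[]" v] by simp
  show "pres_eq R (u' @ v) (u' @ v')"
    using pres_eq_context[OF assms(2), of u' "[]"] by simp
qed

lemma pres_class_eq_iff: "pres_rel R `` {u} = pres_rel R `` {v} \<longleftrightarrow> pres_eq R u v"
  using eq_equiv_class_iff[OF equiv_pres_rel, of u v R] by (simp add: pres_rel_def)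

lemma presented_group_carrier: "carrier (presented_group R) = range (\<lambda>u. pres_rel R `` {u})"
  by (auto simp: presented_group_def quotient_def)

lemma presented_group_one: "\<one>\<^bsub>presented_group R\<^esub> = pres_rel R `` {[]}"
  by (simp add: presented_group_def)

lemma presented_group_mult:
  "pres_rel R `` {u} \<otimes>\<^bsub>presented_group R\<^esub> pres_rel R `` {v} = pres_rel R `` {u @ v}"
proof -
  have "pres_rel R `` {u' @ v'} = pres_rel R `` {u @ v}"
    if "u' \<in> pres_rel R `` {u}" "v' \<in> pres_rel R `` {v}" for u' v'
  proof -
    have "pres_eq R u u'" "pres_eq R v v'"
      using that by (simp_all add: pres_rel_def)
    from pres_eq.sym[OF pres_eq_append[OF this]] show ?thesis
      by (simp only: pres_class_eq_iff)
  qed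
  then have "(\<Union>u'\<in>pres_rel R `` {u}. \<Union>v'\<in>pres_rel R `` {v}. pres_rel R `` {u' @ v'})
      = (\<Union>u'\<in>pres_rel R `` {u}. \<Union>v'\<in>pres_rel R `` {v}. pres_rel R `` {u @ v})"
    by (intro SUP_cong HOL.refl)
  moreover have "u \<in> pres_rel R `` {u}" "v \<in> pres_rel R `` {v}"
    by (simp_all add: pres_rel_def pres_eq.refl)
  then have "pres_rel R `` {u} \<noteq> {}" "pres_rel R `` {v} \<noteq> {}"
    by (metis empty_iff)+
  ultimately show ?thesis
    by (simp only: presented_group_def monoid.simps UN_constant if_False)
qed

lemma word_inv_left: "pres_eq R (word_inv w @ w) []"
proof (induction w)
  case Nil
  show ?case by (simp add: word_inv_def pres_eq.refl)
next
  case (Cons x w)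
  have "letter_inv (letter_inv x) = x" by (cases x) auto
  with pres_eq.cancel[of R "word_inv w" "letter_inv x" w]
  have "pres_eq R (word_inv (x # w) @ x # w) (word_inv w @ w)"
    by (simp add: word_inv_def)
  then show ?case using Cons.IH by (rule pres_eq.trans)
qed

lemma group_presented_group: "group (presented_group R)"
proof (rule groupI)
  fix X assume "X \<in> carrier (presented_group R)"
  then obtain u where X: "X = pres_rel R `` {u}"
    unfolding presented_group_carrier by (elim imageE)
  have "pres_rel R `` {word_inv u} \<otimes>\<^bsub>presented_group R\<^esub> X = \<one>\<^bsub>presented_group R\<^esub>"
    unfolding X presented_group_mult presented_group_one pres_class_eq_iff by (rule word_inv_left)
  then show "\<exists>Y\<in>carrier (presented_group R). Y \<otimes>\<^bsub>presented_group R\<^esub> X = \<one>\<^bsub>presented_group R\<^esub>"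
    unfolding presented_group_carrier by (intro bexI[of _ "pres_rel R `` {word_inv u}"] rangeI)
qed (auto simp only: presented_group_carrier presented_group_one presented_group_mult
      append_assoc append_Nil)

definition word_eval :: "('a, 'b) monoid_scheme \<Rightarrow> ('g \<Rightarrow> 'a) \<Rightarrow> 'g word \<Rightarrow> 'a" where
  "word_eval H f w =
     foldr (\<lambda>x y. (case x of Pos g \<Rightarrow> f g | Neg g \<Rightarrow> inv\<^bsub>H\<^esub> f g) \<otimes>\<^bsub>H\<^esub> y) w \<one>\<^bsub>H\<^esub>"

text \<open>Von Dyck's theorem: the universal property of the presentation.\<close>

lemma presented_group_lift:
  fixes H :: "('a, 'b) monoid_scheme" (structure)
  assumes "group H" and f: "\<And>g. f g \<in> carrier H"
    and R: "\<And>l r. (l, r) \<in> R \<Longrightarrow> word_eval H f l = word_eval H f r"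
  shows "\<exists>h \<in> hom (presented_group R) H. \<forall>w. h (pres_rel R `` {w}) = word_eval H f w"
proof -
  interpret group H by fact
  have closed: "word_eval H f w \<in> carrier H" for w
    by (induction w) (auto simp: word_eval_def f split: letter.split)
  have append: "word_eval H f (u @ v) = word_eval H f u \<otimes> word_eval H f v" for u v
  proof (induction u)
    case Nil
    show ?case using closed[of v] by (simp add: word_eval_def)
  next
    case (Cons x u)
    define c where "c = (case x of Pos g \<Rightarrow> f g | Neg g \<Rightarrow> inv f g)"
    have step: "word_eval H f (x # w) = c \<otimes> word_eval H f w" for w
      by (simp add: word_eval_def c_def)
    have "c \<in> carrier H"
      by (cases x) (simp_all add: c_def f)
    then show ?case
      using closed[of u] closed[of v] by (simp add: step Cons.IH m_assoc)
  qed
  have inverse: "word_eval H f [x, letter_inv x] = \<one>" for x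
    by (cases x) (simp_all add: word_eval_def f)
  have eq: "word_eval H f u = word_eval H f v" if "pres_eq R u v" for u v
    using that
  proof (induction rule: pres_eq.induct)
    case (cancel u x v)
    then show ?case using append[of u "[x, letter_inv x] @ v"] append[of "[x, letter_inv x]" v]
      by (simp only: inverse append closed l_one)
  next
    case (rel l r u v)
    show ?case by (simp only: append R[OF rel])
  qed simp_all
  define h where "h X = word_eval H f (SOME w. w \<in> X)" for X
  have h: "h (pres_rel R `` {w}) = word_eval H f w" for w
  proof -
    have "w \<in> pres_rel R `` {w}" by (simp add: pres_rel_def pres_eq.refl)
    then have "(SOME w'. w' \<in> pres_rel R `` {w}) \<in> pres_rel R `` {w}" by (rule someI)
    then show ?thesis using eq by (simp add: h_def pres_rel_def)
  qed
  have "h \<in> hom (presented_group R) H"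
    by (rule homI) (auto simp: presented_group_carrier presented_group_mult h append closed)
  with h show ?thesis by blast
qed

datatype gen = gen_a | gen_b

abbreviation wa :: "gen word" where "wa \<equiv> [Pos gen_a]"
abbreviation wb :: "gen word" where "wb \<equiv> [Pos gen_b]"

definition dihedral_group :: "nat \<Rightarrow> gen word set monoid" where  \<comment> \<open>\<open>D\<close> of order \<open>2n\<close>\<close>
  "dihedral_group n = presented_group
     {(word_pow wa n, []), (word_pow wb 2, []), (wb @ wa @ word_inv wb, word_inv wa)}"

definition dicyclic_group :: "nat \<Rightarrow> gen word set monoid" where  \<comment> \<open>\<open>Q\<close> of order \<open>4n\<close>\<close>
  "dicyclic_group n = presented_group
     {(word_pow wa (2 * n), []), (word_pow wa n, word_pow wb 2),
      (wb @ wa @ word_inv wb, word_inv wa)}"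

definition quasidihedral_group :: "nat \<Rightarrow> gen word set monoid" where  \<comment> \<open>\<open>QD\<close> of order \<open>2 ^ n\<close>\<close>
  "quasidihedral_group n = presented_group
     {(word_pow wa (2 ^ (n - 1)), []), (word_pow wb 2, []),
      (wb @ wa @ word_inv wb, word_pow wa (2 ^ (n - 2) - 1))}"

definition V_group :: "nat \<Rightarrow> gen word set monoid" where  \<comment> \<open>\<open>V\<close> of order \<open>8n\<close>\<close>
  "V_group n = presented_group
     {(word_pow wa (2 * n), []), (word_pow wb 4, []),
      (wb @ wa, word_inv wa @ word_inv wb), (word_inv wb @ wa, word_inv wa @ wb)}"

definition SD_group :: "nat \<Rightarrow> gen word set monoid" where  \<comment> \<open>\<open>SD\<close> of order \<open>8n\<close>\<close>
  "SD_group n = presented_group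
     {(word_pow wa (4 * n), []), (word_pow wb 2, []),
      (wb @ wa @ word_inv wb, word_pow wa (2 * n - 1))}"

definition U_group :: "nat \<Rightarrow> gen word set monoid" where  \<comment> \<open>\<open>U\<close> of order \<open>6n\<close>\<close>
  "U_group n = presented_group
     {(word_pow wa (2 * n), []), (word_pow wb 3, []), (word_inv wa @ wb @ wa, word_inv wb)}"

definition M_group :: "nat \<Rightarrow> nat \<Rightarrow> gen word set monoid" where  \<comment> \<open>\<open>M\<close> of order \<open>2mn\<close>\<close>
  "M_group m n = presented_group
     {(word_pow wa m, []), (word_pow wb (2 * n), []), (wb @ wa @ word_inv wb, word_inv wa)}"

section \<open>Simple graphs\<close>

text \<open>
  A simple graph is a loop-free symmetric digraph without parallel arcs: each edge
  is represented by its two orientations (cf. the locale \<open>pair_graph\<close>).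
\<close>

definition ESCom :: "('a, 'b) monoid_scheme \<Rightarrow> 'a pair_pre_digraph" where
  "ESCom G =
     \<lparr> pverts = carrier G,
       parcs = {(g, h). g \<in> carrier G \<and> h \<in> carrier G \<and> g \<noteq> h \<and> g \<otimes>\<^bsub>G\<^esub> h = h \<otimes>\<^bsub>G\<^esub> g} \<rparr>"

definition complete_graph :: "nat \<Rightarrow> nat pair_pre_digraph" where
  "complete_graph r = \<lparr> pverts = {..<r}, parcs = {(i, j). i < r \<and> j < r \<and> i \<noteq> j} \<rparr>"

definition graph_union :: "'a pair_pre_digraph \<Rightarrow> 'b pair_pre_digraph \<Rightarrow> ('a + 'b) pair_pre_digraph"
  (infixr \<open>\<squnion>\<^sub>G\<close> 65) where
  "G \<squnion>\<^sub>G H =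
     \<lparr> pverts = pverts G <+> pverts H,
       parcs = map_prod Inl Inl ` parcs G \<union> map_prod Inr Inr ` parcs H \<rparr>"

definition graph_join :: "'a pair_pre_digraph \<Rightarrow> 'b pair_pre_digraph \<Rightarrow> ('a + 'b) pair_pre_digraph"
  (infixr \<open>\<or>\<^sub>G\<close> 60) where
  "G \<or>\<^sub>G H =
     \<lparr> pverts = pverts G <+> pverts H,
       parcs = parcs (G \<squnion>\<^sub>G H) \<union> (Inl ` pverts G) \<times> (Inr ` pverts H)
                 \<union> (Inr ` pverts H) \<times> (Inl ` pverts G) \<rparr>"

definition graph_copies :: "nat \<Rightarrow> 'a pair_pre_digraph \<Rightarrow> (nat \<times> 'a) pair_pre_digraph" where
  "graph_copies s G =
     \<lparr> pverts = {..<s} \<times> pverts G,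
       parcs = {((i, u), (j, v)). i < s \<and> i = j \<and> (u, v) \<in> parcs G} \<rparr>"

definition graph_iso :: "'a pair_pre_digraph \<Rightarrow> 'b pair_pre_digraph \<Rightarrow> bool"
  (infix \<open>\<cong>\<^sub>G\<close> 50) where
  "G \<cong>\<^sub>G H \<longleftrightarrow> digraph_iso (with_proj G) (with_proj H)"

lemma complete_digraph_complete_graph: "complete_digraph r (with_proj (complete_graph r))"
  by (auto simp: complete_digraph_pair_def complete_graph_def)

lemma graph_iso_iff:
  assumes "pair_wf_digraph G" "pair_wf_digraph H"
  shows "G \<cong>\<^sub>G H \<longleftrightarrow>
    (\<exists>f. bij_betw f (pverts G) (pverts H) \<and>
         (\<forall>u\<in>pverts G. \<forall>v\<in>pverts G. (u, v) \<in> parcs G \<longleftrightarrow> (f u, f v) \<in> parcs H))" (is "_ \<longleftrightarrow> ?R")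
proof
  assume "G \<cong>\<^sub>G H"
  then obtain h where "pre_digraph.digraph_isomorphism (with_proj G) h"
    and H: "with_proj H = app_iso h (with_proj G)"
    by (auto simp: graph_iso_def digraph_iso_def)
  then have inj: "inj_on (iso_verts h) (pverts G)"
    and ends: "\<And>a. a \<in> parcs G \<Longrightarrow>
      iso_verts h (fst a) = iso_tail h (iso_arcs h a) \<and> iso_verts h (snd a) = iso_head h (iso_arcs h a)"
    by (auto simp: pre_digraph.digraph_isomorphism_def)
  have pv: "pverts H = iso_verts h ` pverts G" and pa: "parcs H = iso_arcs h ` parcs G"
    and ft: "iso_tail h = fst" "iso_head h = snd"
    using arg_cong[OF H, of verts] arg_cong[OF H, of arcs]
      arg_cong[OF H, of tail] arg_cong[OF H, of head] by simp_all
  have arc: "iso_arcs h (u, v) = (iso_verts h u, iso_verts h v)" if "(u, v) \<in> parcs G" for u v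
    using ends[OF that] unfolding ft by (simp add: prod_eq_iff)
  have "(u, v) \<in> parcs G \<longleftrightarrow> (iso_verts h u, iso_verts h v) \<in> parcs H"
    if "u \<in> pverts G" "v \<in> pverts G" for u v
  proof
    assume "(u, v) \<in> parcs G"
    then show "(iso_verts h u, iso_verts h v) \<in> parcs H"
      using arc[of u v] imageI[of "(u, v)" "parcs G" "iso_arcs h"] pa by simp
  next
    assume "(iso_verts h u, iso_verts h v) \<in> parcs H"
    then obtain u' v' where uv: "(u', v') \<in> parcs G"
      "(iso_verts h u, iso_verts h v) = iso_arcs h (u', v')"
      unfolding pa by (metis imageE prod.collapse)
    then have "u' \<in> pverts G" "v' \<in> pverts G"
      using pair_wf_digraph.in_arcsD1[OF assms(1)] pair_wf_digraph.in_arcsD2[OF assms(1)] by blast+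
    moreover have "iso_verts h u = iso_verts h u'" "iso_verts h v = iso_verts h v'"
      using uv(2) arc[OF uv(1)] by simp_all
    ultimately have "u = u'" "v = v'"
      using inj_onD[OF inj] that by blast+
    then show "(u, v) \<in> parcs G"
      using uv(1) by simp
  qed
  moreover have "bij_betw (iso_verts h) (pverts G) (pverts H)"
    using inj pv by (simp add: bij_betw_def)
  ultimately show ?R
    by (intro exI[of _ "iso_verts h"] conjI ballI)
next
  assume ?R
  then obtain f where f: "bij_betw f (pverts G) (pverts H)"
    and "\<forall>u\<in>pverts G. \<forall>v\<in>pverts G. (u, v) \<in> parcs G \<longleftrightarrow> (f u, f v) \<in> parcs H"
    by (elim exE conjE)
  then have adj: "(u, v) \<in> parcs G \<longleftrightarrow> (f u, f v) \<in> parcs H"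
    if "u \<in> pverts G" "v \<in> pverts G" for u v
    using that by simp
  interpret G: pair_wf_digraph G by fact
  interpret H: pair_wf_digraph H by fact
  have inj: "inj_on f (pverts G)" and im: "f ` pverts G = pverts H"
    using f by (auto simp: bij_betw_def)
  let ?h = "\<lparr>iso_verts = f, iso_arcs = map_prod f f, iso_head = snd, iso_tail = fst\<rparr>"
  have "inj_on (map_prod f f) (parcs G)"
    by (rule inj_on_subset[OF map_prod_inj_on[OF inj inj]]) (auto dest: G.wellformed')
  then have "pre_digraph.digraph_isomorphism (with_proj G) ?h"
    using inj G.wf_digraph_axioms by (auto simp: pre_digraph.digraph_isomorphism_def)
  moreover have "parcs H = map_prod f f ` parcs G"
  proof (intro equalityI subsetI)
    fix e assume e: "e \<in> parcs H"
    then have "fst e \<in> f ` pverts G" "snd e \<in> f ` pverts G"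
      using H.arc_fst_in_verts H.arc_snd_in_verts im by auto
    then obtain u v where "u \<in> pverts G" "v \<in> pverts G" "e = (f u, f v)"
      by (metis imageE prod.collapse)
    with e adj have "(u, v) \<in> parcs G" "e = map_prod f f (u, v)" by simp_all
    then show "e \<in> map_prod f f ` parcs G" by blast
  next
    fix e assume "e \<in> map_prod f f ` parcs G"
    then obtain u v where "(u, v) \<in> parcs G" "e = (f u, f v)" by auto
    then show "e \<in> parcs H" using adj[of u v] G.wellformed'[of u v] by blast
  qed
  then have "with_proj H = app_iso ?h (with_proj G)"
    using im by (simp add: with_proj_def app_iso_def)
  ultimately show "G \<cong>\<^sub>G H"
    unfolding graph_iso_def digraph_iso_def by (intro exI[of _ ?h] conjI)
qed

end

theory Submission
  imports Defs "HOL-Algebra.Elementary_Groups"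
begin

text \<open>
  All seven families consist of groups with an abelian subgroup \<open>A\<close> of index two. For such a group
  the commuting graph depends on two numbers only: the order of \<open>A\<close>, and the number \<open>k\<close> of elements of
  \<open>A\<close> that commute with a fixed element \<open>x\<close> outside \<open>A\<close>. The commuting elements of \<open>A\<close> are joined to
  everything, the rest of \<open>A\<close> is one clique, and two elements of the outer coset commute exactly when they
  differ by one of the \<open>k\<close> commuting elements. If \<open>A\<close> has order \<open>s k\<close>, the graph is therefore the join of
  \<open>K\<^sub>k\<close> with the disjoint union of a complete graph on \<open>s k - k\<close> vertices and \<open>s\<close> copies of \<open>K\<^sub>k\<close>
  (\<open>ESCom_abelian_index_two\<close>).

  To apply this to a presentation one has to know that the presented group is as large as expected. In
  all cases \<open>A\<close> is a product of cyclic groups of orders \<open>p\<close> and \<open>q\<close>, the second factor is central, and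
  \<open>x\<close> acts by \<open>(i, j) \<mapsto> (r i, s i + j)\<close> with \<open>x\<^sup>2 = (t1, t2)\<close>. One explicit model with these
  parameters serves for every family: a homomorphism from the presented group to the model exists because
  the model satisfies the defining relations, and one in the other direction because the presented group satisfies the
  relations of the model (\<open>twisted_lift\<close>, \<open>presented_group_isoI\<close>). What remains for each family is an
  equivalence between two sets of relations, valid in any group, and a count of the residues \<open>i\<close> modulo \<open>p\<close> with
  \<open>p dvd (r - 1) i\<close> and \<open>q dvd s i\<close>.

  The parameters \<open>(p, q, r, s, t1, t2)\<close> are \<open>(m, n, -1, 0, 0, 1)\<close> for \<open>M\<close> of order \<open>2 m n\<close>,
  \<open>(2 n, 1, -1, 0, n, 0)\<close> for \<open>Q\<close>, \<open>(4 n, 1, 2 n - 1, 0, 0, 0)\<close> for \<open>SD\<close> and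
  \<open>(2 n, 2, -1, 1, 0, 1)\<close> for \<open>V\<close>. The dihedral groups are the case \<open>n = 1\<close> of \<open>M\<close>, the quasidihedral
  groups are among the groups \<open>SD\<close>, and \<open>U\<close> has the parameters of \<open>M\<close> with \<open>m = 3\<close> after
  its two letters are exchanged.
\<close>

section \<open>Isomorphisms of joins and disjoint unions\<close>

lemma pair_wf_ESCom: "pair_wf_digraph (ESCom G)"
  by unfold_locales (auto simp: ESCom_def)

lemma pair_wf_complete_graph: "pair_wf_digraph (complete_graph r)"
  by unfold_locales (auto simp: complete_graph_def)

lemma pair_wf_graph_union:
  assumes "pair_wf_digraph G" "pair_wf_digraph H"
  shows "pair_wf_digraph (G \<squnion>\<^sub>G H)"
proof -
  interpret G: pair_wf_digraph G by fact
  interpret H: pair_wf_digraph H by fact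
  show ?thesis
    by unfold_locales (auto simp: graph_union_def dest: G.wellformed' H.wellformed')
qed

lemma pair_wf_graph_join:
  assumes "pair_wf_digraph G" "pair_wf_digraph H"
  shows "pair_wf_digraph (G \<or>\<^sub>G H)"
proof -
  interpret G: pair_wf_digraph G by fact
  interpret H: pair_wf_digraph H by fact
  show ?thesis
    by unfold_locales (auto simp: graph_join_def graph_union_def dest: G.wellformed' H.wellformed')
qed

lemma pair_wf_graph_copies:
  assumes "pair_wf_digraph G"
  shows "pair_wf_digraph (graph_copies s G)"
proof -
  interpret G: pair_wf_digraph G by fact
  show ?thesis
    by unfold_locales (auto simp: graph_copies_def dest: G.wellformed')
qed

lemmas pair_wf_intros =
  pair_wf_ESCom pair_wf_complete_graph pair_wf_graph_union pair_wf_graph_join pair_wf_graph_copies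

lemma arcs_graph_union:
  "(Inl i, Inl j) \<in> parcs (G \<squnion>\<^sub>G H) \<longleftrightarrow> (i, j) \<in> parcs G"
  "(Inr p, Inr q) \<in> parcs (G \<squnion>\<^sub>G H) \<longleftrightarrow> (p, q) \<in> parcs H"
  "(Inl i, Inr q) \<notin> parcs (G \<squnion>\<^sub>G H)" "(Inr p, Inl j) \<notin> parcs (G \<squnion>\<^sub>G H)"
  by (auto simp: graph_union_def map_prod_def intro: rev_image_eqI)

lemma arcs_graph_join:
  "(Inl i, Inl j) \<in> parcs (G \<or>\<^sub>G H) \<longleftrightarrow> (i, j) \<in> parcs G"
  "(Inr p, Inr q) \<in> parcs (G \<or>\<^sub>G H) \<longleftrightarrow> (p, q) \<in> parcs H"
  "(Inl i, Inr q) \<in> parcs (G \<or>\<^sub>G H) \<longleftrightarrow> i \<in> pverts G \<and> q \<in> pverts H"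
  "(Inr p, Inl j) \<in> parcs (G \<or>\<^sub>G H) \<longleftrightarrow> p \<in> pverts H \<and> j \<in> pverts G"
  by (auto simp: graph_join_def arcs_graph_union)

lemma graph_iso_trans:
  assumes wf: "pair_wf_digraph G" "pair_wf_digraph H" "pair_wf_digraph K"
    and "G \<cong>\<^sub>G H" "H \<cong>\<^sub>G K"
  shows "G \<cong>\<^sub>G K"
proof -
  obtain f where f: "bij_betw f (pverts G) (pverts H)"
    "\<forall>u\<in>pverts G. \<forall>v\<in>pverts G. (u, v) \<in> parcs G \<longleftrightarrow> (f u, f v) \<in> parcs H"
    using assms(4) graph_iso_iff[OF wf(1,2)] by blast
  obtain g where g: "bij_betw g (pverts H) (pverts K)"
    "\<forall>u\<in>pverts H. \<forall>v\<in>pverts H. (u, v) \<in> parcs H \<longleftrightarrow> (g u, g v) \<in> parcs K"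
    using assms(5) graph_iso_iff[OF wf(2,3)] by blast
  have "f u \<in> pverts H" if "u \<in> pverts G" for u
    using f(1) that by (rule bij_betwE[THEN bspec])
  then show ?thesis
    unfolding graph_iso_iff[OF wf(1,3)]
    using bij_betw_trans[OF f(1) g(1)] f(2) g(2) by (intro exI[of _ "g \<circ> f"]) simp
qed

lemma graph_join_union_commute:
  assumes wf: "pair_wf_digraph G" "pair_wf_digraph H" "pair_wf_digraph K"
  shows "G \<or>\<^sub>G (H \<squnion>\<^sub>G K) \<cong>\<^sub>G G \<or>\<^sub>G (K \<squnion>\<^sub>G H)"
proof -
  let ?f = "map_sum id (case_sum Inr Inl) :: 'a + ('b + 'c) \<Rightarrow> 'a + ('c + 'b)"
  have "bij_betw ?f (pverts (G \<or>\<^sub>G (H \<squnion>\<^sub>G K))) (pverts (G \<or>\<^sub>G (K \<squnion>\<^sub>G H)))"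
    by (rule bij_betw_byWitness[where f' = "map_sum id (case_sum Inr Inl)"])
      (auto simp: graph_join_def graph_union_def)
  then show ?thesis
    unfolding graph_iso_iff[OF pair_wf_graph_join[OF wf(1) pair_wf_graph_union[OF wf(2,3)]]
        pair_wf_graph_join[OF wf(1) pair_wf_graph_union[OF wf(3,2)]]]
    by (intro exI[of _ ?f]) (auto simp: graph_join_def graph_union_def image_iff Bex_def)
qed

lemma ESCom_iso:
  assumes "h \<in> iso G H" "group G"
  shows "ESCom G \<cong>\<^sub>G ESCom H"
proof -
  have bij: "bij_betw h (carrier G) (carrier H)" and hom: "h \<in> hom G H"
    using assms(1) by (auto simp: iso_def)
  interpret group G by fact
  have "(u, v) \<in> parcs (ESCom G) \<longleftrightarrow> (h u, h v) \<in> parcs (ESCom H)"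
    if "u \<in> carrier G" "v \<in> carrier G" for u v
    using that bij hom_in_carrier[OF hom] inj_on_eq_iff[OF bij_betw_imp_inj_on[OF bij]]
    by (simp add: ESCom_def flip: hom_mult[OF hom])
  then show ?thesis
    using bij by (subst graph_iso_iff[OF pair_wf_ESCom pair_wf_ESCom])
      (auto intro!: exI[of _ h] simp: ESCom_def)
qed

section \<open>Groups with an abelian subgroup of index two\<close>

text \<open>
  A set that a map \<open>c\<close> cuts into fibres of equal size is a grid: the first coordinate numbers
  the fibres and the second the elements inside a fibre. The vertices outside the abelian subgroup
  are matched in this way with \<open>s\<close> disjoint copies of \<open>K\<^sub>k\<close>.
\<close>
lemma ex_bij_fibres:
  fixes c :: "'a \<Rightarrow> 'b"
  assumes "finite B" and fib: "\<And>u. u \<in> B \<Longrightarrow> card {v \<in> B. c v = c u} = k"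
    and card: "card B = s * k" and "k > 0"
  shows "\<exists>f. bij_betw f B ({..<s} \<times> {..<k}) \<and>
    (\<forall>u\<in>B. \<forall>v\<in>B. fst (f u) = fst (f v) \<longleftrightarrow> c u = c v)"
proof -
  have fin: "finite (c ` B)" using assms(1) by simp
  \<comment> \<open>counting \<open>B\<close> fibre by fibre shows that there are \<open>s\<close> of them\<close>
  have "card B = (\<Sum>y\<in>c ` B. card {v \<in> B. c v = y})"
    unfolding card_eq_sum by (rule sum.image_gen[OF assms(1)])
  also have "\<dots> = (\<Sum>y\<in>c ` B. k)"
    by (rule sum.cong) (auto simp: fib)
  finally have "card (c ` B) = s"
    using card \<open>k > 0\<close> by simp
  then obtain e where e: "bij_betw e (c ` B) {..<s}"
    using fin ex_bij_betw_finite_nat atLeast0LessThan by metis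
  have "\<exists>p. bij_betw p {v \<in> B. c v = y} {..<k}" if y: "y \<in> c ` B" for y
  proof -
    have "card {v \<in> B. c v = y} = k" using y fib by auto
    then show ?thesis
      using ex_bij_betw_finite_nat[of "{v \<in> B. c v = y}"] assms(1) by (simp add: atLeast0LessThan)
  qed
  then obtain p where p: "\<And>y. y \<in> c ` B \<Longrightarrow> bij_betw (p y) {v \<in> B. c v = y} {..<k}"
    by metis
  let ?f = "\<lambda>u. (e (c u), p (c u) u)"
  have e_eq: "e (c u) = e (c v) \<longleftrightarrow> c u = c v" if "u \<in> B" "v \<in> B" for u v
    using inj_on_eq_iff[OF bij_betw_imp_inj_on[OF e]] that by auto
  have inj: "inj_on ?f B"
  proof (rule inj_onI)
    fix u v assume uv: "u \<in> B" "v \<in> B" and "?f u = ?f v"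
    then have "c u = c v" "p (c v) u = p (c v) v" using e_eq by auto
    then show "u = v"
      using inj_onD[OF bij_betw_imp_inj_on[OF p[of "c v"]], of u v] uv by auto
  qed
  have "?f ` B \<subseteq> {..<s} \<times> {..<k}"
    using e p by (fastforce simp: bij_betw_def)
  then have "?f ` B = {..<s} \<times> {..<k}"
    using card_image[OF inj] card by (intro card_subset_eq) auto
  then show ?thesis
    using inj e_eq by (intro exI[of _ ?f]) (auto simp: bij_betw_def)
qed

text \<open>
  The set \<open>Z\<close> of elements of \<open>A\<close> commuting with \<open>x\<close> decides every edge. An element
  \<open>w\<close> of \<open>A\<close> and an element \<open>y x\<close> of the outer coset satisfy \<open>(y x) w = y (x w)\<close> and, because
  \<open>A\<close> is abelian, \<open>w (y x) = y (w x)\<close>; so they commute exactly when \<open>w\<close> is in \<open>Z\<close>, whatever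
  \<open>y\<close> is. If \<open>u\<close> and \<open>v\<close> both lie in the outer coset then \<open>v = w u\<close> with \<open>w\<close> in \<open>A\<close>, and
  \<open>u\<close> commutes with \<open>w u\<close> exactly when it commutes with \<open>w\<close>, that is when \<open>u\<close> and \<open>v\<close> lie
  in the same coset of \<open>Z\<close>. Hence \<open>Z\<close> is joined to everything, \<open>A - Z\<close> is a clique
  without edges to the outer coset, and the outer coset splits into \<open>s\<close> cliques of size \<open>k\<close>.
\<close>
lemma (in group) ESCom_abelian_index_two:
  assumes A: "subgroup A G" "finite A"
    and comm: "\<And>y z. y \<in> A \<Longrightarrow> z \<in> A \<Longrightarrow> y \<otimes> z = z \<otimes> y"
    and x: "x \<in> carrier G" "x \<notin> A" and cover: "carrier G = A \<union> (A #> x)"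
    and k: "card {z \<in> A. x \<otimes> z = z \<otimes> x} = k" and s: "card A = s * k"
  shows "ESCom G \<cong>\<^sub>G
    complete_graph k \<or>\<^sub>G (complete_graph (s * k - k) \<squnion>\<^sub>G graph_copies s (complete_graph k))"
proof -
  interpret A: subgroup A G by fact
  define Z where "Z = {z \<in> A. x \<otimes> z = z \<otimes> x}"
  define B where "B = A #> x"
  have ZA: "Z \<subseteq> A" by (auto simp: Z_def)
  have Z: "subgroup Z G"
  proof (rule subgroupI)
    fix y assume "y \<in> Z"
    then have y: "y \<in> A" "y \<in> carrier G" and eq: "y \<otimes> x = x \<otimes> y" by (auto simp: Z_def)
    have "x \<otimes> inv y = inv y \<otimes> (y \<otimes> x) \<otimes> inv y"
      using x(1) y(2) by (simp flip: m_assoc)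
    also have "\<dots> = inv y \<otimes> x"
      unfolding eq using x(1) y(2) by (simp add: m_assoc)
    finally show "inv y \<in> Z" using y by (simp add: Z_def)
  next
    fix y z assume "y \<in> Z" "z \<in> Z"
    then have yz: "y \<in> carrier G" "z \<in> carrier G" "y \<in> A" "z \<in> A"
      and eq: "x \<otimes> y = y \<otimes> x" "x \<otimes> z = z \<otimes> x" by (auto simp: Z_def)
    have "x \<otimes> (y \<otimes> z) = x \<otimes> y \<otimes> z" using x(1) yz(1,2) by (simp add: m_assoc)
    also have "\<dots> = y \<otimes> (x \<otimes> z)" unfolding eq(1) using x(1) yz(1,2) by (simp add: m_assoc)
    also have "\<dots> = y \<otimes> z \<otimes> x" unfolding eq(2) using x(1) yz(1,2) by (simp add: m_assoc)
    finally show "y \<otimes> z \<in> Z" using yz by (simp add: Z_def)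
  next
    have "\<one> \<in> Z" using x(1) by (simp add: Z_def)
    then show "Z \<noteq> {}" by blast
  qed (use ZA A.subset in blast)
  interpret Z: subgroup Z G by fact
  have finZ: "finite Z" using ZA A(2) by (rule finite_subset)
  have cardZ: "card Z = k" using k by (simp add: Z_def)
  have kpos: "k > 0" using cardZ finZ Z.one_closed card_gt_0_iff by blast
  have B_carrier: "B \<subseteq> carrier G" unfolding B_def using cover by auto
  have BE: "\<exists>y\<in>A. u = y \<otimes> x" if "u \<in> B" for u
    using that by (auto simp: B_def r_coset_def)
  have disj: "A \<inter> B = {}"
  proof -
    have "x \<in> A" if "y \<in> A" "y \<otimes> x \<in> A" for y
      using A.m_closed[OF A.m_inv_closed[OF that(1)] that(2)] that x by (simp flip: m_assoc)
    then show ?thesis using x(2) BE by blast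
  qed
  have carr: "carrier G = A \<union> B" by (simp add: cover B_def)
  have cardB: "card B = card A"
    unfolding B_def using card_rcosets_equal[OF rcosetsI[OF A.subset x(1)] A.subset] by simp
  have finB: "finite B" using cardB s A(2) x unfolding B_def r_coset_def by auto
  have uA: "u \<otimes> w = w \<otimes> u \<longleftrightarrow> w \<in> Z" if "u \<in> B" "w \<in> A" for u w
  proof -
    obtain y where y: "y \<in> A" "u = y \<otimes> x" using BE[OF \<open>u \<in> B\<close>] by blast
    have cl: "y \<in> carrier G" "w \<in> carrier G" using y(1) that(2) by auto
    have "w \<otimes> u = w \<otimes> y \<otimes> x" using cl x(1) y(2) by (simp add: m_assoc)
    also have "\<dots> = y \<otimes> (w \<otimes> x)"
      unfolding comm[OF that(2) y(1)] using cl x(1) by (simp add: m_assoc)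
    finally have wu: "w \<otimes> u = y \<otimes> (w \<otimes> x)" .
    have "u \<otimes> w = y \<otimes> (x \<otimes> w)" using y(2) cl x(1) by (simp add: m_assoc)
    then have "u \<otimes> w = w \<otimes> u \<longleftrightarrow> x \<otimes> w = w \<otimes> x"
      unfolding wu using cl x(1) by simp
    then show ?thesis using that(2) by (simp add: Z_def)
  qed
  have uv: "u \<otimes> v = v \<otimes> u \<longleftrightarrow> Z #> u = Z #> v" if "u \<in> B" "v \<in> B" for u v
  proof -
    obtain y z where yz: "y \<in> A" "u = y \<otimes> x" "z \<in> A" "v = z \<otimes> x" 
      using BE[OF \<open>u \<in> B\<close>] BE[OF \<open>v \<in> B\<close>] by blast
    \<comment> \<open>the element of \<open>A\<close> that carries \<open>u\<close> to \<open>v\<close>\<close>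
    define w where "w = z \<otimes> inv y"
    have cl: "y \<in> carrier G" "z \<in> carrier G" using yz by auto
    have w: "w \<in> A" using yz by (simp add: w_def)
    then have wc: "w \<in> carrier G" by simp
    have "inv y \<otimes> (y \<otimes> x) = x" using cl x(1) by (simp flip: m_assoc)
    then have v: "v = w \<otimes> u"
      unfolding w_def yz(2,4) using cl x(1) by (simp add: m_assoc)
    have u: "u \<in> carrier G" using that B_carrier by blast
    have "u \<otimes> v = v \<otimes> u \<longleftrightarrow> (u \<otimes> w) \<otimes> u = (w \<otimes> u) \<otimes> u"
      unfolding v using u wc by (simp add: m_assoc)
    also have "\<dots> \<longleftrightarrow> u \<otimes> w = w \<otimes> u"
      using u wc by simp
    also have "\<dots> \<longleftrightarrow> w \<in> Z" using uA that w by blast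
    also have "\<dots> \<longleftrightarrow> v \<in> Z #> u"
      unfolding v r_coset_def using wc u ZA A.subset by auto
    also have "\<dots> \<longleftrightarrow> Z #> u = Z #> v"
      using repr_independence[OF _ u Z] rcos_self[OF _ Z, of v] u v wc by auto
    finally show ?thesis .
  qed
  have ZuB: "Z #> u \<subseteq> B" if "u \<in> B" for u
  proof
    fix v assume "v \<in> Z #> u"
    then obtain z where "z \<in> Z" "v = z \<otimes> u" by (auto simp: r_coset_def)
    moreover obtain y where "y \<in> A" "u = y \<otimes> x" using BE \<open>u \<in> B\<close> by blast
    ultimately have "v = (z \<otimes> y) \<otimes> x" "z \<otimes> y \<in> A" using ZA x by (auto simp: m_assoc)
    then show "v \<in> B" by (auto simp: B_def r_coset_def)
  qed
  have fib: "card {v \<in> B. Z #> v = Z #> u} = k" if "u \<in> B" for u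
  proof -
    have u: "u \<in> carrier G" using that B_carrier by blast
    have "v \<in> Z #> u" if "v \<in> B" "Z #> v = Z #> u" for v
      using rcos_self[of v, OF _ Z] that B_carrier by blast
    then have "{v \<in> B. Z #> v = Z #> u} = Z #> u"
      using ZuB[OF that] repr_independence[OF _ u Z] by blast
    then show ?thesis
      using card_rcosets_equal[OF rcosetsI[OF Z.subset u] Z.subset] cardZ by simp
  qed
  obtain f3 where f3: "bij_betw f3 B ({..<s} \<times> {..<k})"
    "\<And>u v. u \<in> B \<Longrightarrow> v \<in> B \<Longrightarrow> fst (f3 u) = fst (f3 v) \<longleftrightarrow> Z #> u = Z #> v"
    using ex_bij_fibres[OF finB fib _ kpos] cardB s by metis
  obtain f1 where f1: "bij_betw f1 Z {..<k}"
    using ex_bij_betw_finite_nat[OF finZ] cardZ by (auto simp: atLeast0LessThan)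
  obtain f2 where f2: "bij_betw f2 (A - Z) {..<s * k - k}"
    using ex_bij_betw_finite_nat[of "A - Z"] A(2) card_Diff_subset[OF finZ ZA] cardZ s
    by (auto simp: atLeast0LessThan)
  define f where
    "f g = (if g \<in> Z then Inl (f1 g) else if g \<in> A then Inr (Inl (f2 g)) else Inr (Inr (f3 g)))" for g
  have fZ: "f v = Inl (f1 v)" if "v \<in> Z" for v
    using that by (simp add: f_def)
  have fA: "f v = Inr (Inl (f2 v))" if "v \<in> A" "v \<notin> Z" for v
    using that by (simp add: f_def)
  have fB: "f v = Inr (Inr (f3 v))" if "v \<in> B" for v
    using that ZA disj by (auto simp: f_def)
  let ?K = "complete_graph k \<or>\<^sub>G
    (complete_graph (s * k - k) \<squnion>\<^sub>G graph_copies s (complete_graph k))"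
  have pv: "pverts ?K = {..<k} <+> ({..<s * k - k} <+> {..<s} \<times> {..<k})"
    by (simp add: graph_join_def graph_union_def complete_graph_def graph_copies_def)
  have bij: "bij_betw f (carrier G) (pverts ?K)"
  proof -
    have "bij_betw f (Z \<union> ((A - Z) \<union> B)) (Inl ` {..<k} \<union> (Inr ` Inl ` {..<s * k - k} \<union> Inr ` Inr ` ({..<s} \<times> {..<k})))"
    proof (intro bij_betw_combine)
      have "bij_betw (\<lambda>v. Inl (f1 v)) Z (Inl ` {..<k})"
        using f1 by (auto simp: bij_betw_def inj_on_def)
      then show "bij_betw f Z (Inl ` {..<k})"
        by (subst bij_betw_cong[OF fZ])
      have "bij_betw (\<lambda>v. Inr (Inl (f2 v))) (A - Z) (Inr ` Inl ` {..<s * k - k})"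
        using f2 by (auto simp: bij_betw_def inj_on_def image_image)
      then show "bij_betw f (A - Z) (Inr ` Inl ` {..<s * k - k})"
        by (subst bij_betw_cong[OF fA]) auto
      have "bij_betw (\<lambda>v. Inr (Inr (f3 v))) B (Inr ` Inr ` ({..<s} \<times> {..<k}))"
        using f3(1) by (auto simp: bij_betw_def inj_on_def image_image)
      then show "bij_betw f B (Inr ` Inr ` ({..<s} \<times> {..<k}))"
        by (subst bij_betw_cong[OF fB])
    qed auto
    moreover have "Z \<union> ((A - Z) \<union> B) = carrier G" using ZA carr by auto
    ultimately show ?thesis by (simp add: pv Plus_def image_Un)
  qed
  have arc: "(g, h) \<in> parcs (ESCom G) \<longleftrightarrow> (f g, f h) \<in> parcs ?K"
    if gh: "g \<in> carrier G" "h \<in> carrier G" for g h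
  proof -
    have ne: "g \<noteq> h \<longleftrightarrow> f g \<noteq> f h"
      using inj_on_eq_iff[OF bij_betw_imp_inj_on[OF bij] gh] by simp
    have K: "(Inl i, Inl j) \<in> parcs ?K \<longleftrightarrow> i < k \<and> j < k \<and> i \<noteq> j"
      "(Inr (Inl i), Inr (Inl j)) \<in> parcs ?K \<longleftrightarrow> i < s * k - k \<and> j < s * k - k \<and> i \<noteq> j"
      "(Inr (Inr p), Inr (Inr q)) \<in> parcs ?K \<longleftrightarrow>
         p \<in> {..<s} \<times> {..<k} \<and> q \<in> {..<s} \<times> {..<k} \<and> fst p = fst q \<and> p \<noteq> q"
      "(Inr (Inl i), Inr (Inr q)) \<notin> parcs ?K" "(Inr (Inr q), Inr (Inl i)) \<notin> parcs ?K"
      "(Inl i, Inr w) \<in> parcs ?K \<longleftrightarrow> i < k \<and> w \<in> {..<s * k - k} <+> {..<s} \<times> {..<k}"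
      "(Inr w, Inl i) \<in> parcs ?K \<longleftrightarrow> i < k \<and> w \<in> {..<s * k - k} <+> {..<s} \<times> {..<k}"
      for i j p q w
      by (auto simp: arcs_graph_join arcs_graph_union)
        (auto simp: graph_union_def complete_graph_def graph_copies_def)
    have cl: "f g \<in> pverts ?K" "f h \<in> pverts ?K" using bij gh by (auto simp: bij_betw_def)
    have Zcomm: "z \<otimes> v = v \<otimes> z" if "z \<in> Z" "v \<in> carrier G" for z v
      using that uA[of v z] comm[of z v] ZA carr by auto
    have gh': "g \<in> A \<or> g \<in> B" "h \<in> A \<or> h \<in> B" using gh carr by auto
    consider "g \<in> Z" "h \<in> Z" | "g \<in> Z" "h \<notin> Z" | "g \<notin> Z" "h \<in> Z"
      | "g \<in> A" "g \<notin> Z" "h \<in> A" "h \<notin> Z" | "g \<in> A" "g \<notin> Z" "h \<in> B"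
      | "g \<in> B" "h \<in> A" "h \<notin> Z" | "g \<in> B" "h \<in> B"
      using gh' by blast
    then have "(f g, f h) \<in> parcs ?K \<longleftrightarrow> f g \<noteq> f h \<and> g \<otimes> h = h \<otimes> g"
    proof cases
      case 1
      then show ?thesis using cl Zcomm[OF _ gh(2)] unfolding pv by (simp only: fZ K) auto
    next
      case 2
      then have "f h \<in> range Inr" by (auto simp: f_def)
      then show ?thesis
        using cl 2 Zcomm[OF _ gh(2)] unfolding pv by (elim rangeE) (simp only: fZ K, auto)
    next
      case 3
      then have "f g \<in> range Inr" by (auto simp: f_def)
      then show ?thesis
        using cl 3 Zcomm[OF _ gh(1)] unfolding pv by (elim rangeE) (simp only: fZ K, auto)
    next
      case 4
      then show ?thesis
        using cl comm[of g h] fA[OF 4(1,2)] fA[OF 4(3,4)] unfolding pv by (auto simp: K)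
    next
      case 5
      then show ?thesis using uA[of h g] fA[OF 5(1,2)] fB[OF 5(3)] by (auto simp: K)
    next
      case 6
      then show ?thesis using uA[of g h] fB[OF 6(1)] fA[OF 6(2,3)] by (auto simp: K)
    next
      case 7
      then have gh_B: "f g = Inr (Inr (f3 g))" "f h = Inr (Inr (f3 h))" using fB by blast+
      show ?thesis
        using cl unfolding gh_B K uv[OF 7] f3(2)[OF 7] pv by auto
    qed
    then show ?thesis using gh ne by (simp add: ESCom_def)
  qed
  show ?thesis
    unfolding graph_iso_iff[OF pair_wf_ESCom pair_wf_graph_join[OF pair_wf_complete_graph
          pair_wf_graph_union[OF pair_wf_complete_graph pair_wf_graph_copies[OF pair_wf_complete_graph]]]]
    using bij arc by (intro exI[of _ f] conjI ballI) (simp_all add: ESCom_def)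
qed

section \<open>Recognising a group from its presentation\<close>

lemma (in group) word_eval_closed:
  assumes "\<And>g. f g \<in> carrier G"
  shows "word_eval G f w \<in> carrier G"
  by (induction w) (auto simp: word_eval_def assms split: letter.split)

lemma word_eval_Nil: "word_eval G f [] = \<one>\<^bsub>G\<^esub>"
  by (simp add: word_eval_def)

lemma word_eval_Cons:
  "word_eval G f (Pos g # w) = f g \<otimes>\<^bsub>G\<^esub> word_eval G f w"
  "word_eval G f (Neg g # w) = inv\<^bsub>G\<^esub> f g \<otimes>\<^bsub>G\<^esub> word_eval G f w"
  by (simp_all add: word_eval_def)

lemma (in group) word_eval_append:
  assumes "\<And>g. f g \<in> carrier G"
  shows "word_eval G f (u @ v) = word_eval G f u \<otimes> word_eval G f v"
proof (induction u)
  case Nil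
  then show ?case by (simp add: word_eval_Nil word_eval_closed assms)
next
  case (Cons l u)
  then show ?case
    by (cases l) (simp_all add: word_eval_Cons word_eval_closed assms m_assoc)
qed

lemma (in group) word_eval_pow:
  assumes "\<And>g. f g \<in> carrier G"
  shows "word_eval G f (word_pow w k) = word_eval G f w [^] k"
proof (induction k)
  case 0
  then show ?case by (simp add: word_pow_def word_eval_Nil)
next
  case (Suc k)
  have "word_pow w (Suc k) = w @ word_pow w k" by (simp add: word_pow_def)
  then show ?case
    by (simp add: word_eval_append assms Suc word_eval_closed nat_pow_Suc2[symmetric] del: nat_pow_Suc)
qed

lemma word_inv_letter: "word_inv [Pos g] = [Neg g]"
  by (simp add: word_inv_def)

lemma pres_class_in_carrier: "pres_rel R `` {w} \<in> carrier (presented_group R)"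
  unfolding presented_group_carrier by (rule rangeI)

text \<open>
  Evaluating words in the presented group at its own generators gives their classes. This turns
  the defining relations into equations between \<open>word_eval\<close> terms, the same shape in which they
  have to be checked in a candidate model.
\<close>
lemma word_eval_presented_group:
  "word_eval (presented_group R) (\<lambda>g. pres_rel R `` {[Pos g]}) w = pres_rel R `` {w}"
proof (induction w)
  case Nil
  show ?case by (simp add: word_eval_Nil presented_group_one)
next
  case (Cons l w)
  interpret group "presented_group R" by (rule group_presented_group)
  have "inv\<^bsub>presented_group R\<^esub> (pres_rel R `` {[Pos g]}) = pres_rel R `` {[Neg g]}" for g
    by (rule inv_equality)
      (use pres_eq.cancel[of R "[]" "Neg g" "[]"] in
        \<open>simp_all add: presented_group_mult presented_group_one pres_class_in_carrier pres_class_eq_iff\<close>)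
  then show ?case
    by (cases l) (simp_all add: word_eval_Cons Cons presented_group_mult)
qed

lemma presented_group_relation:
  assumes "(l, r) \<in> R"
  shows "word_eval (presented_group R) (\<lambda>g. pres_rel R `` {[Pos g]}) l =
    word_eval (presented_group R) (\<lambda>g. pres_rel R `` {[Pos g]}) r"
  unfolding word_eval_presented_group pres_class_eq_iff
  using pres_eq.rel[OF assms, of "[]" "[]"] by simp

text \<open>
  By von Dyck's theorem the relations give a homomorphism \<open>h\<close> from the presented group to
  \<open>H\<close>. Both composites of \<open>h\<close> and \<open>\<phi>\<close> fix the generators of the group they act on, so they are
  identities and \<open>\<phi>\<close> is bijective. The existence of \<open>\<phi>\<close> bounds the presented group from above
  and plays the part of a normal form computation.
\<close>
lemma presented_group_isoI:
  fixes H :: "('a, 'b) monoid_scheme"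
  assumes H: "group H" and f: "\<And>g. f g \<in> carrier H"
    and rel: "\<And>l r. (l, r) \<in> R \<Longrightarrow> word_eval H f l = word_eval H f r"
    and gen: "generate H (range f) = carrier H"
    and \<phi>: "\<phi> \<in> hom H (presented_group R)" "\<And>g. \<phi> (f g) = pres_rel R `` {[Pos g]}"
  shows "\<phi> \<in> iso H (presented_group R)"
proof -
  interpret H: group H by fact
  interpret G: group "presented_group R" by (rule group_presented_group)
  obtain h where h: "h \<in> hom (presented_group R) H"
    and hw: "\<And>w. h (pres_rel R `` {w}) = word_eval H f w"
    using presented_group_lift[OF H f rel] by blast
  interpret \<phi>: group_hom H "presented_group R" \<phi>
    using \<phi>(1) by unfold_locales
  interpret h: group_hom "presented_group R" H h
    using h by unfold_locales
  have \<phi>_eval: "\<phi> (word_eval H f w) = pres_rel R `` {w}" for w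
  proof -
    have "\<phi> (word_eval H f w) = word_eval (presented_group R) (\<lambda>g. pres_rel R `` {[Pos g]}) w"
    proof (induction w)
      case (Cons l w)
      then show ?case
        by (cases l) (simp_all add: word_eval_Cons f H.word_eval_closed \<phi>(2))
    qed (simp add: word_eval_Nil)
    then show ?thesis by (simp add: word_eval_presented_group)
  qed
  have h\<phi>: "h (\<phi> y) = y" if "y \<in> carrier H" for y
  proof -
    have "y \<in> generate H (range f)" using that gen by simp
    then show ?thesis
    proof (induction rule: generate.induct)
      case (incl y)
      then show ?case by (auto simp: \<phi>(2) hw word_eval_Cons word_eval_Nil f)
    next
      case (inv y)
      then show ?case
        by (auto simp: \<phi>(2) hw word_eval_Cons word_eval_Nil f pres_class_in_carrier)
    next
      case (eng y z)
      then have "y \<in> carrier H" "z \<in> carrier H" using gen by auto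
      then show ?case using eng by simp
    qed simp
  qed
  have "inj_on \<phi> (carrier H)" using h\<phi> by (rule inj_on_inverseI)
  moreover have "\<phi> ` carrier H = carrier (presented_group R)"
  proof
    have "pres_rel R `` {w} \<in> \<phi> ` carrier H" for w
      unfolding \<phi>_eval[symmetric] using H.word_eval_closed[OF f] by (rule imageI)
    then show "carrier (presented_group R) \<subseteq> \<phi> ` carrier H"
      unfolding presented_group_carrier by blast
  qed auto
  ultimately show ?thesis using \<phi>(1) by (simp add: iso_def bij_betw_def)
qed

section \<open>Index-two extensions of abelian groups\<close>

text \<open>
  The pair \<open>(y, d)\<close> stands for \<open>y x\<^sup>d\<close>, where \<open>x\<close> acts on \<open>A\<close> by conjugation as \<open>\<sigma>\<close> and
  \<open>x\<^sup>2 = t\<close>. The truth value records the coset of \<open>A\<close>, so that inequality of truth values is addition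
  modulo two.
\<close>
definition index_two_extension ::
  "('a, 'b) monoid_scheme \<Rightarrow> ('a \<Rightarrow> 'a) \<Rightarrow> 'a \<Rightarrow> ('a \<times> bool) monoid" where
  "index_two_extension A \<sigma> t =
    \<lparr>carrier = carrier A \<times> UNIV,
     monoid.mult = (\<lambda>(y, d) (z, e).
       (y \<otimes>\<^bsub>A\<^esub> (if d then \<sigma> z else z) \<otimes>\<^bsub>A\<^esub> (if d \<and> e then t else \<one>\<^bsub>A\<^esub>), d \<noteq> e)),
     one = (\<one>\<^bsub>A\<^esub>, False)\<rparr>"

text \<open>
  Associativity needs \<open>\<sigma>\<close> to be an involution, since conjugating by \<open>x\<close> twice is conjugating
  by \<open>t\<close>, which is trivial on \<open>A\<close>, and it needs \<open>\<sigma> t = t\<close>, since \<open>x\<close> commutes with \<open>x\<^sup>2\<close>.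
\<close>
lemma group_index_two_extension:
  fixes A (structure)
  assumes "comm_group A" and \<sigma>: "\<sigma> \<in> hom A A" "\<And>y. y \<in> carrier A \<Longrightarrow> \<sigma> (\<sigma> y) = y"
    and t: "t \<in> carrier A" "\<sigma> t = t"
  shows "group (index_two_extension A \<sigma> t)"
proof -
  interpret comm_group A by fact
  have cl [simp]: "\<sigma> y \<in> carrier A" if "y \<in> carrier A" for y
    using \<sigma>(1) that by (rule hom_in_carrier)
  have mult [simp]: "\<sigma> (y \<otimes> z) = \<sigma> y \<otimes> \<sigma> z" if "y \<in> carrier A" "z \<in> carrier A" for y z
    using \<sigma>(1) that by (rule hom_mult)
  have one [simp]: "\<sigma> \<one> = \<one>"
    using hom_one[OF \<sigma>(1)] is_group by blast
  show ?thesis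
  proof (rule groupI)
    fix u assume "u \<in> carrier (index_two_extension A \<sigma> t)"
    then obtain y d where u: "u = (y, d)" "y \<in> carrier A"
      by (auto simp: index_two_extension_def)
    show "\<exists>v\<in>carrier (index_two_extension A \<sigma> t).
        v \<otimes>\<^bsub>index_two_extension A \<sigma> t\<^esub> u = \<one>\<^bsub>index_two_extension A \<sigma> t\<^esub>"
    proof (cases d)
      case True
      have "(inv (\<sigma> y \<otimes> t), True) \<otimes>\<^bsub>index_two_extension A \<sigma> t\<^esub> u = \<one>\<^bsub>index_two_extension A \<sigma> t\<^esub>"
        using True u t by (simp add: index_two_extension_def m_assoc)
      then show ?thesis
        using u t by (intro bexI[of _ "(inv (\<sigma> y \<otimes> t), True)"]) (auto simp: index_two_extension_def)
    next
      case False
      then show ?thesis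
        using u t by (intro bexI[of _ "(inv y, False)"]) (auto simp: index_two_extension_def)
    qed
  qed (auto simp: index_two_extension_def t \<sigma>(2) m_ac)
qed

text \<open>
  A homomorphism from the integers is determined by its value at 1. This computes powers in a
  concrete group from a guessed closed form.
\<close>
lemma (in group) int_pow_unique:
  fixes i :: int
  assumes "\<And>i. \<kappa> i \<in> carrier G" and add: "\<And>i j :: int. \<kappa> (i + j) = \<kappa> i \<otimes> \<kappa> j"
  shows "\<kappa> 1 [^] i = \<kappa> i"
proof -
  have "\<kappa> 0 = \<one>" using add[of 0 0] assms(1)[of 0] by simp
  then show ?thesis
  proof (induction i rule: int_induct[of _ 0])
    case (step1 i)
    then show ?case by (simp add: add int_pow_mult assms(1))
  next
    case (step2 i)
    then show ?case using add[of "i - 1" 1] int_pow_mult[of "\<kappa> 1" "i - 1" 1] assms(1)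
      by (simp add: assms(1))
  qed simp
qed

lemma (in group) int_pow_mod:
  assumes "x \<in> carrier G" "x [^] p = \<one>"
  shows "x [^] (i mod int p) = x [^] i"
proof -
  have "x [^] i = x [^] (int p * (i div int p) + i mod int p)" by simp
  also have "\<dots> = x [^] (i mod int p)"
    unfolding int_pow_mult[OF assms(1)] int_pow_pow[OF assms(1), symmetric] int_pow_int assms(2)
    using assms(1) by simp
  finally show ?thesis by simp
qed

lemma (in group) nat_pow_conj:
  fixes k :: nat
  assumes "x \<in> carrier G" "y \<in> carrier G" "z \<in> carrier G" and eq: "x \<otimes> y = z \<otimes> x"
  shows "x \<otimes> y [^] k = z [^] k \<otimes> x"
proof (induction k)
  case (Suc k)
  have "x \<otimes> y [^] Suc k = (x \<otimes> y [^] k) \<otimes> y" using assms(1,2) by (simp add: m_assoc)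
  also have "\<dots> = z [^] k \<otimes> (x \<otimes> y)" unfolding Suc using assms(1-3) by (simp add: m_assoc)
  also have "\<dots> = z [^] Suc k \<otimes> x" unfolding eq using assms(1-3) by (simp add: m_assoc)
  finally show ?case .
qed (use assms in simp)

section \<open>The common model\<close>

text \<open>
  These are the relations of an extension of \<open>\<langle>a\<rangle> \<times> \<langle>c\<rangle>\<close> by \<open>x\<close>, with \<open>c\<close> central,
  \<open>x a x\<^sup>-\<^sup>1 = a\<^sup>r c\<^sup>s\<close> and \<open>x\<^sup>2\<close> the element of \<open>\<langle>a\<rangle> \<times> \<langle>c\<rangle>\<close> with exponents \<open>t1\<close> and \<open>t2\<close>.
  Stating them for elements of an arbitrary group \<open>K\<close> allows the same relations to be established in a
  presented group and in its model.
\<close>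
definition twisted :: "nat \<Rightarrow> nat \<Rightarrow> int \<Rightarrow> int \<Rightarrow> int \<Rightarrow> int \<Rightarrow> ('a, 'b) monoid_scheme \<Rightarrow> 'a \<Rightarrow> 'a \<Rightarrow> 'a \<Rightarrow> bool" where
  "twisted p q r s t1 t2 K a c x \<longleftrightarrow>
    a \<in> carrier K \<and> c \<in> carrier K \<and> x \<in> carrier K \<and>
    a [^]\<^bsub>K\<^esub> p = \<one>\<^bsub>K\<^esub> \<and> c [^]\<^bsub>K\<^esub> q = \<one>\<^bsub>K\<^esub> \<and>
    c \<otimes>\<^bsub>K\<^esub> a = a \<otimes>\<^bsub>K\<^esub> c \<and> x \<otimes>\<^bsub>K\<^esub> c = c \<otimes>\<^bsub>K\<^esub> x \<and>
    x \<otimes>\<^bsub>K\<^esub> a = a [^]\<^bsub>K\<^esub> r \<otimes>\<^bsub>K\<^esub> c [^]\<^bsub>K\<^esub> s \<otimes>\<^bsub>K\<^esub> x \<and>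
    x \<otimes>\<^bsub>K\<^esub> x = a [^]\<^bsub>K\<^esub> t1 \<otimes>\<^bsub>K\<^esub> c [^]\<^bsub>K\<^esub> t2"

text \<open>
  That \<open>p\<close> divides \<open>r\<^sup>2 - 1\<close> and \<open>q\<close> divides \<open>s (r + 1)\<close> make
  \<open>(i, j) \<mapsto> (r i, s i + j)\<close> an involution; that \<open>q\<close> divides \<open>s p\<close> makes it well defined on
  residues modulo \<open>p\<close> and \<open>q\<close>; the conditions with \<open>t1\<close> say that it fixes \<open>(t1, t2)\<close>. Together they
  are what an index-two extension requires.
\<close>
locale twist =
  fixes p q :: nat and r s t1 t2 :: int
  assumes pos: "p > 0" "q > 0"
    and p_dvd: "int p dvd r * r - 1" "int p dvd r * t1 - t1"
    and q_dvd: "int q dvd s * int p" "int q dvd s * (r + 1)" "int q dvd s * t1"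
begin

abbreviation A :: "(int \<times> int) monoid" where
  "A \<equiv> integer_mod_group p \<times>\<times> integer_mod_group q"

definition \<sigma> :: "int \<times> int \<Rightarrow> int \<times> int" where
  "\<sigma> = (\<lambda>(i, j). (r * i mod int p, (s * i + j) mod int q))"

definition H :: "((int \<times> int) \<times> bool) monoid" where
  "H = index_two_extension A \<sigma> (t1 mod int p, t2 mod int q)"

lemma comm_group_A: "comm_group A"
proof -
  interpret group A by (rule DirProd_group) simp_all
  show ?thesis by (rule group_comm_groupI) (auto simp: add.commute)
qed

lemma s_mod: "s * (i mod int p) mod int q = s * i mod int q"
proof -
  have "s * i - s * (i mod int p) = s * int p * (i div int p)"
    unfolding right_diff_distrib[symmetric] minus_mod_eq_mult_div by simp
  then have "int q dvd s * i - s * (i mod int p)"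
    using dvd_mult2[OF q_dvd(1)] by simp
  then show ?thesis by (simp add: mod_eq_dvd_iff dvd_diff_commute)
qed

lemma s_mod_add: "(s * (i mod int p) + j) mod int q = (s * i + j) mod int q"
  by (rule mod_add_cong[OF s_mod HOL.refl])

lemma \<sigma>_mod: "\<sigma> (i mod int p, j mod int q) = (r * i mod int p, (s * i + j) mod int q)"
  using s_mod_add[of i j] by (simp add: \<sigma>_def mod_simps)

lemma carrier_A: "carrier A = {0..<int p} \<times> {0..<int q}"
  using pos by (simp add: carrier_integer_mod_group)

lemma group_H: "group H"
  unfolding H_def
proof (rule group_index_two_extension[OF comm_group_A])
  show "\<sigma> \<in> hom A A"
  proof (rule homI)
    fix y z assume "y \<in> carrier A" "z \<in> carrier A"
    obtain i j k l where "y = (i, j)" "z = (k, l)" by (cases y, cases z)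
    then show "\<sigma> (y \<otimes>\<^bsub>A\<^esub> z) = \<sigma> y \<otimes>\<^bsub>A\<^esub> \<sigma> z"
      by (simp add: \<sigma>_mod) (simp add: \<sigma>_def mod_simps, simp add: algebra_simps)
  qed (use pos in \<open>auto simp: carrier_integer_mod_group \<sigma>_def\<close>)
next
  fix y assume "y \<in> carrier A"
  then have "y \<in> {0..<int p} \<times> {0..<int q}" by (simp only: carrier_A)
  then obtain i j where y: "y = (i, j)" "0 \<le> i" "i < int p" "0 \<le> j" "j < int q"
    by auto
  have "int p dvd (r * r - 1) * i" using p_dvd(1) by simp
  then have "int p dvd r * (r * i) - i" by (simp add: algebra_simps)
  then have "r * (r * i) mod int p = i" using y by (simp add: mod_eq_dvd_iff[symmetric])
  moreover have "int q dvd s * (r + 1) * i" using q_dvd(2) by simp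
  then have "int q dvd (s * (r * i) + (s * i + j)) - j" by (simp add: algebra_simps)
  then have "(s * (r * i) + (s * i + j)) mod int q = j mod int q" by (simp only: mod_eq_dvd_iff)
  then have "(s * (r * i) + (s * i + j)) mod int q = j" using y by simp
  ultimately show "\<sigma> (\<sigma> y) = y"
    using \<sigma>_mod[of "r * i" "s * i + j"] by (simp add: y(1)) (simp add: \<sigma>_def)
next
  have "r * t1 mod int p = t1 mod int p" using p_dvd(2) by (simp add: mod_eq_dvd_iff)
  moreover have "(s * t1 + t2) mod int q = t2 mod int q" using q_dvd(3) by (simp add: mod_eq_dvd_iff)
  ultimately show "\<sigma> (t1 mod int p, t2 mod int q) = (t1 mod int p, t2 mod int q)"
    by (simp add: \<sigma>_mod)
qed (use pos in \<open>simp add: carrier_integer_mod_group\<close>)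

lemma carrier_H: "carrier H = ({0..<int p} \<times> {0..<int q}) \<times> UNIV"
  using carrier_A by (simp add: H_def index_two_extension_def)

lemma one_H: "\<one>\<^bsub>H\<^esub> = ((0, 0), False)"
  by (simp add: H_def index_two_extension_def)

lemma mult_H:
  "((i, j), False) \<otimes>\<^bsub>H\<^esub> ((k, l), e) = (((i + k) mod int p, (j + l) mod int q), e)"
  "((i, j), True) \<otimes>\<^bsub>H\<^esub> ((k, l), False) = (((i + r * k) mod int p, (j + (s * k + l)) mod int q), True)"
  "((i, j), True) \<otimes>\<^bsub>H\<^esub> ((k, l), True) =
    (((i + r * k + t1) mod int p, (j + (s * k + l) + t2) mod int q), False)"
  by (simp_all add: H_def index_two_extension_def \<sigma>_def mod_simps)

definition a\<^sub>H :: "(int \<times> int) \<times> bool" where "a\<^sub>H = ((1 mod int p, 0), False)"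
definition c\<^sub>H :: "(int \<times> int) \<times> bool" where "c\<^sub>H = ((0, 1 mod int q), False)"
definition x\<^sub>H :: "(int \<times> int) \<times> bool" where "x\<^sub>H = ((0, 0), True)"

lemma generators_in_H: "a\<^sub>H \<in> carrier H" "c\<^sub>H \<in> carrier H" "x\<^sub>H \<in> carrier H"
  using pos by (simp_all add: carrier_H a\<^sub>H_def c\<^sub>H_def x\<^sub>H_def)

lemma pow_H:
  fixes i j :: int
  shows "a\<^sub>H [^]\<^bsub>H\<^esub> i = ((i mod int p, 0), False)" "c\<^sub>H [^]\<^bsub>H\<^esub> j = ((0, j mod int q), False)"
proof -
  interpret group H by (rule group_H)
  show "a\<^sub>H [^]\<^bsub>H\<^esub> i = ((i mod int p, 0), False)"
    unfolding a\<^sub>H_def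
    by (rule int_pow_unique[of "\<lambda>i. ((i mod int p, 0), False)"])
      (use pos in \<open>simp_all add: carrier_H mult_H mod_simps\<close>)
  show "c\<^sub>H [^]\<^bsub>H\<^esub> j = ((0, j mod int q), False)"
    unfolding c\<^sub>H_def
    by (rule int_pow_unique[of "\<lambda>j. ((0, j mod int q), False)"])
      (use pos in \<open>simp_all add: carrier_H mult_H mod_simps\<close>)
qed

lemma normal_form_H:
  "a\<^sub>H [^]\<^bsub>H\<^esub> i \<otimes>\<^bsub>H\<^esub> c\<^sub>H [^]\<^bsub>H\<^esub> j = ((i mod int p, j mod int q), False)"
  by (simp add: pow_H mult_H)

lemma twisted_H: "twisted p q r s t1 t2 H a\<^sub>H c\<^sub>H x\<^sub>H"
proof -
  have "a\<^sub>H [^]\<^bsub>H\<^esub> p = \<one>\<^bsub>H\<^esub>" "c\<^sub>H [^]\<^bsub>H\<^esub> q = \<one>\<^bsub>H\<^esub>"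
    by (simp_all add: pow_H one_H flip: int_pow_int)
  then show ?thesis
    unfolding twisted_def normal_form_H
    by (simp add: generators_in_H) (simp add: a\<^sub>H_def c\<^sub>H_def x\<^sub>H_def mult_H mod_simps s_mod)
qed

lemma generate_H: "generate H {a\<^sub>H, c\<^sub>H, x\<^sub>H} = carrier H"
proof -
  interpret group H by (rule group_H)
  let ?S = "generate H {a\<^sub>H, c\<^sub>H, x\<^sub>H}"
  have gens: "a\<^sub>H \<in> ?S" "c\<^sub>H \<in> ?S" "x\<^sub>H \<in> ?S" by (auto intro: generate.incl)
  have pow: "u [^]\<^bsub>H\<^esub> n \<in> ?S" if "u \<in> ?S" for u and n :: nat
    by (induction n) (auto intro: generate.intros that)
  have "u \<in> ?S" if "u \<in> carrier H" for u
  proof -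
    obtain i j e where u: "u = ((i, j), e)" by (metis surj_pair)
    then have "0 \<le> i" "i < int p" "0 \<le> j" "j < int q"
      using that by (simp_all add: carrier_H)
    then have u_eq: "u = a\<^sub>H [^]\<^bsub>H\<^esub> nat i \<otimes>\<^bsub>H\<^esub> c\<^sub>H [^]\<^bsub>H\<^esub> nat j \<otimes>\<^bsub>H\<^esub> (if e then x\<^sub>H else \<one>\<^bsub>H\<^esub>)"
      using u by (simp add: pow_nat normal_form_H) (simp add: mult_H x\<^sub>H_def one_H)
    have "(if e then x\<^sub>H else \<one>\<^bsub>H\<^esub>) \<in> ?S" using gens(3) generate.one by auto
    then show ?thesis unfolding u_eq by (intro generate.eng pow gens)
  qed
  then show ?thesis using generate_incl[of "{a\<^sub>H, c\<^sub>H, x\<^sub>H}"] generators_in_H by auto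
qed

text \<open>
  Every element of the model has a unique normal form \<open>a\<^sup>i c\<^sup>j x\<^sup>e\<close>, which can be read in \<open>K\<close>.
  The torsion relations make the reading insensitive to reduction modulo \<open>p\<close> and \<open>q\<close>, and the
  conjugation relation moves \<open>x\<close> past \<open>a\<^sup>i c\<^sup>j\<close> in the way in which \<open>\<sigma>\<close> acts, so the reading is a
  homomorphism.
\<close>
lemma twisted_lift:
  fixes K (structure)
  assumes "group K" and tw: "twisted p q r s t1 t2 K a c x"
  shows "\<exists>\<phi>\<in>hom H K. \<phi> a\<^sub>H = a \<and> \<phi> c\<^sub>H = c \<and> \<phi> x\<^sub>H = x"
proof -
  interpret group K by fact
  have K: "a \<in> carrier K" "c \<in> carrier K" "x \<in> carrier K"
    and tors: "a [^] p = \<one>" "c [^] q = \<one>"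
    and ca: "c \<otimes> a = a \<otimes> c" and xc: "x \<otimes> c = c \<otimes> x"
    and xa: "x \<otimes> a = a [^] r \<otimes> c [^] s \<otimes> x" and xx: "x \<otimes> x = a [^] t1 \<otimes> c [^] t2"
    using tw by (simp_all add: twisted_def)
  define \<iota> where "\<iota> i j = a [^] i \<otimes> c [^] j" for i j :: int
  have \<iota>_closed [simp]: "\<iota> i j \<in> carrier K" for i j using K by (simp add: \<iota>_def)
  have ca_pow: "c [^] j \<otimes> a [^] i = a [^] i \<otimes> c [^] j" for i j :: int
  proof -
    \<comment> \<open>torsion allows both exponents to be replaced by natural numbers\<close>
    have "c [^] m \<otimes> a [^] n = a [^] n \<otimes> c [^] m" for m n :: nat
      using nat_pow_conj[of "c [^] m" a a n] group_commutes_pow[OF ca K(2,1)] K by simp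
    from this[of "nat (j mod int q)" "nat (i mod int p)"] show ?thesis
      using pos K tors by (simp add: pow_nat int_pow_mod)
  qed
  have \<iota>_add: "\<iota> i j \<otimes> \<iota> k l = \<iota> (i + k) (j + l)" for i j k l
  proof -
    have "\<iota> i j \<otimes> \<iota> k l = a [^] i \<otimes> (c [^] j \<otimes> a [^] k) \<otimes> c [^] l"
      using K by (simp add: \<iota>_def m_assoc)
    then show ?thesis unfolding ca_pow using K by (simp add: \<iota>_def int_pow_mult m_assoc)
  qed
  have \<iota>_mod: "\<iota> (i mod int p) (j mod int q) = \<iota> i j" for i j
    using K tors by (simp add: \<iota>_def int_pow_mod)
  have x\<iota>: "x \<otimes> \<iota> i j = \<iota> (r * i) (s * i + j) \<otimes> x" if "0 \<le> i" "0 \<le> j" for i j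
  proof -
    have "a [^] r \<otimes> c [^] s = \<iota> r s" by (simp add: \<iota>_def)
    moreover have "\<iota> r s [^] i = \<iota> (r * i) (s * i)"
      using int_pow_unique[of "\<lambda>i. \<iota> (r * i) (s * i)" i] by (simp add: \<iota>_add algebra_simps)
    ultimately have xa_pow: "x \<otimes> a [^] i = \<iota> (r * i) (s * i) \<otimes> x"
      using nat_pow_conj[of x a "\<iota> r s" "nat i"] K xa that by (simp add: pow_nat)
    have xc_pow: "x \<otimes> c [^] j = c [^] j \<otimes> x"
      using nat_pow_conj[of x c c "nat j"] K xc that by (simp add: pow_nat)
    have "x \<otimes> \<iota> i j = x \<otimes> a [^] i \<otimes> c [^] j"
      using K by (simp add: \<iota>_def m_assoc)
    also have "\<dots> = \<iota> (r * i) (s * i) \<otimes> (x \<otimes> c [^] j)"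
      unfolding xa_pow using K by (simp add: m_assoc)
    also have "\<dots> = \<iota> (r * i) (s * i) \<otimes> \<iota> 0 j \<otimes> x"
      unfolding xc_pow using K by (simp add: \<iota>_def m_assoc)
    finally show ?thesis by (simp add: \<iota>_add)
  qed
  define \<phi> where "\<phi> = (\<lambda>((i, j), e). \<iota> i j \<otimes> (if e then x else \<one>))"
  have "\<phi> \<in> hom H K"
  proof (rule homI)
    fix u v assume "u \<in> carrier H" "v \<in> carrier H"
    then obtain i j d k l e where u: "u = ((i, j), d)" and v: "v = ((k, l), e)" and kl: "0 \<le> k" "0 \<le> l"
      by (cases u, cases v) (auto simp: carrier_H)
    have step: "\<iota> i j \<otimes> x \<otimes> \<iota> k l = \<iota> (i + r * k) (j + (s * k + l)) \<otimes> x"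
    proof -
      have "\<iota> i j \<otimes> x \<otimes> \<iota> k l = \<iota> i j \<otimes> (x \<otimes> \<iota> k l)" using K by (simp add: m_assoc)
      also have "\<dots> = \<iota> i j \<otimes> \<iota> (r * k) (s * k + l) \<otimes> x"
        unfolding x\<iota>[OF kl] using K by (simp add: m_assoc)
      finally show ?thesis by (simp add: \<iota>_add)
    qed
    have "\<iota> i j \<otimes> x \<otimes> (\<iota> k l \<otimes> x) = \<iota> i j \<otimes> x \<otimes> \<iota> k l \<otimes> x"
      using K by (simp add: m_assoc)
    also have "\<dots> = \<iota> (i + r * k) (j + (s * k + l)) \<otimes> \<iota> t1 t2"
      unfolding step using K xx by (simp add: m_assoc \<iota>_def)
    finally have step2: "\<iota> i j \<otimes> x \<otimes> (\<iota> k l \<otimes> x) = \<iota> (i + r * k + t1) (j + (s * k + l) + t2)"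
      by (simp add: \<iota>_add)
    show "\<phi> (u \<otimes>\<^bsub>H\<^esub> v) = \<phi> u \<otimes> \<phi> v"
      unfolding u v using K
      by (cases d; cases e) (simp_all add: mult_H \<phi>_def \<iota>_mod step step2 \<iota>_add flip: m_assoc)
  qed (use K in \<open>auto simp: \<phi>_def\<close>)
  moreover have "\<phi> a\<^sub>H = a" "\<phi> c\<^sub>H = c" "\<phi> x\<^sub>H = x"
    using K tors by (simp_all add: \<phi>_def a\<^sub>H_def c\<^sub>H_def x\<^sub>H_def \<iota>_def int_pow_mod)
  ultimately show ?thesis by blast
qed

end

context twist
begin

text \<open>
  Conjugation by \<open>x\<close> fixes \<open>(i, j)\<close> when \<open>p\<close> divides \<open>(r - 1) i\<close> and \<open>q\<close> divides \<open>s i\<close>, with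
  no condition on \<open>j\<close>; the commuting set of the general lemma therefore has \<open>k q\<close> elements.
\<close>
lemma ESCom_H:
  assumes k: "card {i \<in> {0..<int p}. int p dvd r * i - i \<and> int q dvd s * i} = k" and n: "p = n * k"
  shows "ESCom H \<cong>\<^sub>G complete_graph (k * q) \<or>\<^sub>G
    (complete_graph (n * (k * q) - k * q) \<squnion>\<^sub>G graph_copies n (complete_graph (k * q)))"
proof -
  interpret group H by (rule group_H)
  define B where "B = ({0..<int p} \<times> {0..<int q}) \<times> {False}"
  have snd_mult: "snd (u \<otimes>\<^bsub>H\<^esub> v) = (snd u \<noteq> snd v)" for u v
    by (cases u; cases v) (simp add: H_def index_two_extension_def)
  \<comment> \<open>the map \<open>snd\<close> is a homomorphism to the group of order two, with kernel \<open>B\<close>\<close>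
  have B_iff: "u \<in> B \<longleftrightarrow> u \<in> carrier H \<and> \<not> snd u" for u
    by (cases u) (auto simp: B_def carrier_H)
  show ?thesis
  proof (rule ESCom_abelian_index_two)
    show "subgroup B H"
    proof (rule subgroupI)
      show "B \<noteq> {}" using pos by (auto simp: B_def)
    next
      fix u assume "u \<in> B"
      then show "inv\<^bsub>H\<^esub> u \<in> B"
        using snd_mult[of u "inv\<^bsub>H\<^esub> u"] by (simp add: B_iff) (simp add: one_H)
    qed (auto simp: B_iff snd_mult)
    show "finite B" by (simp add: B_def)
    show "u \<otimes>\<^bsub>H\<^esub> v = v \<otimes>\<^bsub>H\<^esub> u" if "u \<in> B" "v \<in> B" for u v
      using that by (auto simp: B_def mult_H add.commute)
    show "x\<^sub>H \<in> carrier H" by (rule generators_in_H)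
    show "x\<^sub>H \<notin> B" by (simp add: B_def x\<^sub>H_def)
    show "carrier H = B \<union> (B #>\<^bsub>H\<^esub> x\<^sub>H)"
    proof (intro equalityI subsetI)
      fix u assume u: "u \<in> carrier H"
      obtain i j e where ij: "u = ((i, j), e)" by (metis surj_pair)
      have "u \<in> B \<or> u = ((i, j), False) \<otimes>\<^bsub>H\<^esub> x\<^sub>H \<and> ((i, j), False) \<in> B"
        using u by (cases e) (auto simp: ij B_def carrier_H x\<^sub>H_def mult_H)
      then show "u \<in> B \<union> (B #>\<^bsub>H\<^esub> x\<^sub>H)" by (auto simp: r_coset_def)
    next
      fix u assume "u \<in> B \<union> (B #>\<^bsub>H\<^esub> x\<^sub>H)"
      then show "u \<in> carrier H"
        using generators_in_H(3) by (auto simp: r_coset_def B_iff)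
    qed
    have "{z \<in> B. x\<^sub>H \<otimes>\<^bsub>H\<^esub> z = z \<otimes>\<^bsub>H\<^esub> x\<^sub>H} =
      ({i \<in> {0..<int p}. int p dvd r * i - i \<and> int q dvd s * i} \<times> {0..<int q}) \<times> {False}"
    proof -
      have "r * i mod int p = i \<longleftrightarrow> int p dvd r * i - i" if "0 \<le> i" "i < int p" for i
        using mod_eq_dvd_iff[of "r * i" "int p" i] that by simp
      moreover have "(s * i + j) mod int q = j \<longleftrightarrow> int q dvd s * i" if "0 \<le> j" "j < int q" for i j
        using mod_eq_dvd_iff[of "s * i + j" "int q" j] that by simp
      ultimately show ?thesis
        by (auto simp: B_def x\<^sub>H_def mult_H)
    qed
    then show "card {z \<in> B. x\<^sub>H \<otimes>\<^bsub>H\<^esub> z = z \<otimes>\<^bsub>H\<^esub> x\<^sub>H} = k * q"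
      using k by (simp add: card_cartesian_product)
    have "card B = p * q" by (simp add: B_def card_cartesian_product)
    then show "card B = n * (k * q)" using n by simp
  qed
qed

text \<open>
  The premises \<open>H_iff\<close> and \<open>R_iff\<close> are meant as two instances of one equivalence, valid in
  every group, between the defining relations and the relations of the model. In the model it is used
  to verify the defining relations, in the presented group to verify those of the model.
  The generators are \<open>a\<close> and \<open>x\<close>; the word \<open>w\<close> expresses \<open>c\<close> in them. The premise
  \<open>R_iff\<close> names the generator map \<open>g\<close> so that an equivalence proved for arbitrary generator
  maps matches it.
\<close>
lemma ESCom_presented_group:
  fixes u v :: 'g
  assumes gens: "UNIV = {u, v}" "f u = a\<^sub>H" "f v = x\<^sub>H"
    and c: "word_eval H f w = c\<^sub>H"
    and H_iff: "(\<forall>(l, r)\<in>R. word_eval H f l = word_eval H f r) \<longleftrightarrow>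
      twisted p q r s t1 t2 H (f u) (word_eval H f w) (f v)"
    and R_iff: "\<And>g. g = (\<lambda>x. pres_rel R `` {[Pos x]}) \<Longrightarrow>
      (\<forall>(l, r)\<in>R. word_eval (presented_group R) g l = word_eval (presented_group R) g r) \<longleftrightarrow>
      twisted p q r s t1 t2 (presented_group R) (g u) (word_eval (presented_group R) g w) (g v)"
    and k: "card {i \<in> {0..<int p}. int p dvd r * i - i \<and> int q dvd s * i} = k" and n: "p = n * k"
    and M: "M = k * q" and N: "N = n * M - M"
  shows "ESCom (presented_group R) \<cong>\<^sub>G
    complete_graph M \<or>\<^sub>G (complete_graph N \<squnion>\<^sub>G graph_copies n (complete_graph M))"
proof -
  have rel: "\<forall>(l, r)\<in>R. word_eval H f l = word_eval H f r"
    unfolding H_iff gens(2,3) c by (rule twisted_H)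
  have "twisted p q r s t1 t2 (presented_group R) (pres_rel R `` {[Pos u]})
      (word_eval (presented_group R) (\<lambda>x. pres_rel R `` {[Pos x]}) w) (pres_rel R `` {[Pos v]})"
    using R_iff[OF HOL.refl] presented_group_relation[of _ _ R] by blast
  then have tw: "twisted p q r s t1 t2 (presented_group R) (pres_rel R `` {[Pos u]})
      (pres_rel R `` {w}) (pres_rel R `` {[Pos v]})"
    unfolding word_eval_presented_group .
  interpret group H by (rule group_H)
  have range: "range f = {a\<^sub>H, x\<^sub>H}" unfolding gens(1) by (simp add: gens(2,3))
  have f: "f g \<in> carrier H" for g
    using generators_in_H range by (metis insertE rangeI singletonD)
  obtain \<phi> where \<phi>: "\<phi> \<in> hom H (presented_group R)"
    "\<phi> a\<^sub>H = pres_rel R `` {[Pos u]}" "\<phi> x\<^sub>H = pres_rel R `` {[Pos v]}"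
    using twisted_lift[OF group_presented_group tw] by blast
  have \<phi>f: "\<phi> (f g) = pres_rel R `` {[Pos g]}" for g
  proof -
    have "g = u \<or> g = v" using gens(1) by blast
    then show ?thesis using gens(2,3) \<phi>(2,3) by auto
  qed
  have sub: "subgroup (generate H (range f)) H"
    by (rule generate_is_subgroup) (use f in blast)
  have "word_eval H f l \<in> generate H (range f)" for l
  proof (induction l)
    case Nil
    then show ?case by (simp add: word_eval_Nil generate.one)
  next
    case (Cons x l)
    then show ?case
      by (cases x) (auto simp: word_eval_Cons intro: generate.intros)
  qed
  from this[of w] have "{a\<^sub>H, c\<^sub>H, x\<^sub>H} \<subseteq> generate H (range f)"
    unfolding c range by (auto intro: generate.incl)
  then have "carrier H \<subseteq> generate H (range f)"
    using generate_subgroup_incl[OF _ sub] generate_H by blast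
  then have gen: "generate H (range f) = carrier H"
    using generate_incl[of "range f"] f by blast
  have "\<phi> \<in> iso H (presented_group R)"
    using rel by (intro presented_group_isoI[OF group_H f _ gen \<phi>(1) \<phi>f]) auto
  then obtain \<psi> where "\<psi> \<in> iso (presented_group R) H"
    using iso_set_sym by blast
  then have "ESCom (presented_group R) \<cong>\<^sub>G ESCom H"
    using group_presented_group by (rule ESCom_iso)
  then show ?thesis
    unfolding M N using ESCom_H[OF k n] by (rule graph_iso_trans[rotated 3]) (intro pair_wf_intros)+
qed

end

section \<open>The defining relations in an arbitrary group\<close>

context group
begin

lemma conj_eq_iff:
  assumes "a \<in> carrier G" "b \<in> carrier G" "y \<in> carrier G"
  shows "b \<otimes> (a \<otimes> inv b) = y \<longleftrightarrow> b \<otimes> a = y \<otimes> b"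
proof
  assume "b \<otimes> a = y \<otimes> b"
  then have "b \<otimes> a \<otimes> inv b = y" using assms by (simp add: m_assoc)
  then show "b \<otimes> (a \<otimes> inv b) = y" using assms by (simp add: m_assoc)
next
  assume "b \<otimes> (a \<otimes> inv b) = y"
  then have "y \<otimes> b = b \<otimes> (a \<otimes> inv b) \<otimes> b" by simp
  also have "\<dots> = b \<otimes> a" using assms by (simp add: m_assoc)
  finally show "b \<otimes> a = y \<otimes> b" ..
qed

lemma pow_two: "b \<in> carrier G \<Longrightarrow> b [^] (2::nat) = b \<otimes> b"
  by (simp add: numeral_2_eq_2)

lemma pow_square:
  assumes "b \<in> carrier G"
  shows "(b \<otimes> b) [^] (n::nat) = b [^] (2 * n)"
  using nat_pow_pow[OF assms, of 2 n] by (simp add: pow_two assms)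

lemma inverts_iff:
  assumes "a \<in> carrier G" "b \<in> carrier G"
  shows "b \<otimes> a = inv a \<otimes> b \<longleftrightarrow> a \<otimes> b = b \<otimes> inv a"
proof -
  have "b \<otimes> a = inv a \<otimes> b \<longleftrightarrow> a \<otimes> (b \<otimes> a) \<otimes> inv a = a \<otimes> (inv a \<otimes> b) \<otimes> inv a"
    using assms by simp
  also have "a \<otimes> (b \<otimes> a) \<otimes> inv a = a \<otimes> b" using assms by (simp add: m_assoc)
  also have "a \<otimes> (inv a \<otimes> b) \<otimes> inv a = b \<otimes> inv a" using assms by (simp flip: m_assoc)
  finally show ?thesis .
qed

text \<open>
  If \<open>b\<close> inverts \<open>a\<close> then \<open>b\<^sup>2\<close> centralises \<open>a\<close>, so \<open>c = b\<^sup>2\<close> serves as the central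
  generator.
\<close>
lemma twisted_inversion_iff:
  assumes a: "a \<in> carrier G" and b: "b \<in> carrier G"
  shows "twisted m n (-1) 0 0 1 G a (b \<otimes> b) b \<longleftrightarrow>
    a [^] m = \<one> \<and> b [^] (2 * n) = \<one> \<and> b \<otimes> a = inv a \<otimes> b"
proof -
  have "b \<otimes> b \<otimes> a = a \<otimes> (b \<otimes> b)" if eq: "b \<otimes> a = inv a \<otimes> b"
  proof -
    have "b \<otimes> b \<otimes> a = b \<otimes> inv a \<otimes> b" using a b eq by (simp add: m_assoc)
    also have "\<dots> = a \<otimes> (b \<otimes> b)"
      unfolding iffD1[OF inverts_iff[OF a b] eq, symmetric] using a b by (simp add: m_assoc)
    finally show ?thesis .
  qed
  then show ?thesis
    using a b int_pow_neg[OF a, of 1] by (auto simp: twisted_def pow_square m_assoc)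
qed

text \<open>
  Here \<open>c = b\<^sup>2\<close> again. From \<open>b\<^sup>-\<^sup>1 a = a\<^sup>-\<^sup>1 b\<close> follows \<open>b a\<^sup>-\<^sup>1 = a b\<^sup>-\<^sup>1\<close>, whence
  \<open>b\<^sup>2 a = b a\<^sup>-\<^sup>1 b\<^sup>-\<^sup>1 = a b\<^sup>-\<^sup>2 = a b\<^sup>2\<close>, so \<open>b\<^sup>2\<close> is central. With \<open>b\<^sup>4 = 1\<close> the relation
  \<open>b a = a\<^sup>-\<^sup>1 b\<^sup>-\<^sup>1\<close> reads \<open>b a b\<^sup>-\<^sup>1 = a\<^sup>-\<^sup>1 b\<^sup>2\<close>, which is the action with \<open>r = -1\<close> and
  \<open>s = 1\<close>.
\<close>
lemma twisted_V_iff: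
  assumes a: "a \<in> carrier G" and b: "b \<in> carrier G"
  shows "twisted (2 * n) 2 (-1) 1 0 1 G a (b \<otimes> b) b \<longleftrightarrow>
    a [^] (2 * n) = \<one> \<and> b [^] (4::nat) = \<one> \<and> b \<otimes> a = inv a \<otimes> inv b \<and> inv b \<otimes> a = inv a \<otimes> b"
    (is "_ \<longleftrightarrow> ?rels")
proof -
  have pow: "(b \<otimes> b) [^] (2::nat) = b [^] (4::nat)" using pow_square[OF b, of 2] by simp
  have tw: "twisted (2 * n) 2 (-1) 1 0 1 G a (b \<otimes> b) b \<longleftrightarrow>
    a [^] (2 * n) = \<one> \<and> b [^] (4::nat) = \<one> \<and> b \<otimes> b \<otimes> a = a \<otimes> (b \<otimes> b) \<and>
    b \<otimes> a = inv a \<otimes> (b \<otimes> b \<otimes> b)"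
    using a b int_pow_neg[OF a, of 1] by (auto simp: twisted_def pow m_assoc)
  have cube: "b \<otimes> b \<otimes> b = inv b" and inv_sq: "inv b \<otimes> inv b = b \<otimes> b" if "b [^] (4::nat) = \<one>"
  proof -
    have four: "(b \<otimes> b \<otimes> b) \<otimes> b = \<one>"
      using that b by (simp add: numeral_eq_Suc m_assoc)
    then show cube: "b \<otimes> b \<otimes> b = inv b" using b by (simp add: inv_equality)
    have "inv b \<otimes> inv b = (b \<otimes> b \<otimes> b) \<otimes> inv b" by (simp add: cube)
    then show "inv b \<otimes> inv b = b \<otimes> b" using b by (simp add: m_assoc)
  qed
  show ?thesis
  proof
    assume "twisted (2 * n) 2 (-1) 1 0 1 G a (b \<otimes> b) b"
    then have t: "a [^] (2 * n) = \<one>" "b [^] (4::nat) = \<one>" "b \<otimes> b \<otimes> a = a \<otimes> (b \<otimes> b)"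
      "b \<otimes> a = inv a \<otimes> (b \<otimes> b \<otimes> b)" using tw by auto
    have ba: "b \<otimes> a = inv a \<otimes> inv b" using t(4) cube[OF t(2)] by simp
    have "inv b \<otimes> a = b \<otimes> b \<otimes> (b \<otimes> a)"
      using b a by (simp add: m_assoc flip: cube[OF t(2)])
    also have "\<dots> = b \<otimes> b \<otimes> inv a \<otimes> inv b" unfolding ba using a b by (simp add: m_assoc)
    also have "b \<otimes> b \<otimes> inv a = inv a \<otimes> (b \<otimes> b)"
    proof -
      have "inv a \<otimes> (b \<otimes> b) = inv a \<otimes> (b \<otimes> b \<otimes> a) \<otimes> inv a" using a b by (simp add: m_assoc)
      also have "\<dots> = b \<otimes> b \<otimes> inv a" unfolding t(3) using a b by (simp flip: m_assoc)
      finally show ?thesis ..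
    qed
    also have "inv a \<otimes> (b \<otimes> b) \<otimes> inv b = inv a \<otimes> b" using a b by (simp add: m_assoc)
    finally show ?rels using t ba by blast
  next
    assume r: ?rels
    then have r4: "b [^] (4::nat) = \<one>" and r1: "b \<otimes> a = inv a \<otimes> inv b"
      and r2: "inv b \<otimes> a = inv a \<otimes> b" by auto
    have "b \<otimes> inv a = a \<otimes> (inv a \<otimes> b) \<otimes> inv a" using a b by (simp flip: m_assoc)
    also have "\<dots> = a \<otimes> inv b" unfolding r2[symmetric] using a b by (simp add: m_assoc)
    finally have r3: "b \<otimes> inv a = a \<otimes> inv b" .
    have "b \<otimes> b \<otimes> a = b \<otimes> inv a \<otimes> inv b" using a b r1 by (simp add: m_assoc)
    also have "\<dots> = a \<otimes> (inv b \<otimes> inv b)" unfolding r3 using a b by (simp add: m_assoc)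
    finally have "b \<otimes> b \<otimes> a = a \<otimes> (b \<otimes> b)" by (simp add: inv_sq[OF r4])
    then show "twisted (2 * n) 2 (-1) 1 0 1 G a (b \<otimes> b) b"
      unfolding tw cube[OF r4] using r by blast
  qed
qed

text \<open>
  With \<open>q = 1\<close> the central factor disappears and the abelian subgroup is the cyclic group
  generated by \<open>a\<close>.
\<close>
lemma twisted_cyclic_iff:
  assumes a: "a \<in> carrier G" and b: "b \<in> carrier G"
  shows "twisted p 1 r 0 t 0 G a \<one> b \<longleftrightarrow>
    a [^] p = \<one> \<and> b \<otimes> b = a [^] t \<and> b \<otimes> a = a [^] r \<otimes> b"
  using a b by (auto simp: twisted_def)

end

lemma UNIV_gen: "UNIV = {gen_a, gen_b}"
  using gen.exhaust by auto

abbreviation "M_relations m n \<equiv>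
  {(word_pow wa m, []), (word_pow wb (2 * n), []), (wb @ wa @ word_inv wb, word_inv wa)}"

abbreviation "U_relations n \<equiv>
  {(word_pow wa (2 * n), []), (word_pow wb 3, []), (word_inv wa @ wb @ wa, word_inv wb)}"

abbreviation "Q_relations n \<equiv>
  {(word_pow wa (2 * n), []), (word_pow wa n, word_pow wb 2), (wb @ wa @ word_inv wb, word_inv wa)}"

abbreviation "SD_relations n \<equiv>
  {(word_pow wa (4 * n), []), (word_pow wb 2, []),
   (wb @ wa @ word_inv wb, word_pow wa (2 * n - 1))}"

abbreviation "V_relations n \<equiv>
  {(word_pow wa (2 * n), []), (word_pow wb 4, []),
   (wb @ wa, word_inv wa @ word_inv wb), (word_inv wb @ wa, word_inv wa @ wb)}"

context group
begin

lemma M_relations_iff: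
  assumes "\<And>g. f g \<in> carrier G"
  shows "(\<forall>(l, r)\<in>M_relations m n. word_eval G f l = word_eval G f r) \<longleftrightarrow>
    twisted m n (-1) 0 0 1 G (f gen_a) (word_eval G f [Pos gen_b, Pos gen_b]) (f gen_b)"
  by (simp add: word_inv_letter word_eval_Cons word_eval_Nil word_eval_pow assms conj_eq_iff
      twisted_inversion_iff)

text \<open>
  In this presentation \<open>a\<close> inverts \<open>b\<close>, so the two letters exchange their roles.
\<close>
lemma U_relations_iff:
  assumes "\<And>g. f g \<in> carrier G"
  shows "(\<forall>(l, r)\<in>U_relations n. word_eval G f l = word_eval G f r) \<longleftrightarrow>
    twisted 3 n (-1) 0 0 1 G (f gen_b) (word_eval G f [Pos gen_a, Pos gen_a]) (f gen_a)"
proof -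
  let ?a = "f gen_a" and ?b = "f gen_b"
  have "inv ?a \<otimes> (?b \<otimes> ?a) = inv ?b \<longleftrightarrow> ?b \<otimes> ?a = ?a \<otimes> inv ?b"
    using assms inv_solve_left' by (metis inv_closed m_closed)
  also have "\<dots> \<longleftrightarrow> ?a \<otimes> ?b = inv ?b \<otimes> ?a"
    using inverts_iff[of ?b ?a] assms by simp
  finally show ?thesis
    by (simp add: word_inv_letter word_eval_Cons word_eval_Nil word_eval_pow assms
        twisted_inversion_iff) blast
qed

lemma Q_relations_iff:
  assumes "\<And>g. f g \<in> carrier G"
  shows "(\<forall>(l, r)\<in>Q_relations n. word_eval G f l = word_eval G f r) \<longleftrightarrow>
    twisted (2 * n) 1 (-1) 0 (int n) 0 G (f gen_a) (word_eval G f []) (f gen_b)"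
  by (auto simp: word_inv_letter word_eval_Cons word_eval_Nil word_eval_pow assms conj_eq_iff
      twisted_cyclic_iff int_pow_neg int_pow_int pow_two simp del: One_nat_def)

lemma SD_relations_iff:
  assumes "\<And>g. f g \<in> carrier G" and "n > 0"
  shows "(\<forall>(l, r)\<in>SD_relations n. word_eval G f l = word_eval G f r) \<longleftrightarrow>
    twisted (4 * n) 1 (2 * int n - 1) 0 0 0 G (f gen_a) (word_eval G f []) (f gen_b)"
proof -
  have "f gen_a [^] (2 * int n - 1) = f gen_a [^] (2 * n - 1)"
    using int_pow_int[of G "f gen_a" "2 * n - 1"] \<open>n > 0\<close> by (simp add: of_nat_diff)
  then show ?thesis
    by (simp add: word_inv_letter word_eval_Cons word_eval_Nil word_eval_pow assms(1) conj_eq_iff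
        twisted_cyclic_iff pow_two del: One_nat_def)
qed

lemma V_relations_iff:
  assumes "\<And>g. f g \<in> carrier G"
  shows "(\<forall>(l, r)\<in>V_relations n. word_eval G f l = word_eval G f r) \<longleftrightarrow>
    twisted (2 * n) 2 (-1) 1 0 1 G (f gen_a) (word_eval G f [Pos gen_b, Pos gen_b]) (f gen_b)"
  by (simp add: word_inv_letter word_eval_Cons word_eval_Nil word_eval_pow assms twisted_V_iff)

end

section \<open>The graphs of the seven families\<close>

lemma card_dvd_below: "d > 0 \<Longrightarrow> card {i \<in> {0..<int (k * d)}. int d dvd i} = k"
proof -
  assume d: "d > 0"
  have "{i \<in> {0..<int (k * d)}. int d dvd i} = (\<lambda>j. int d * j) ` {0..<int k}"
  proof (intro equalityI subsetI)
    fix i assume "i \<in> {i \<in> {0..<int (k * d)}. int d dvd i}"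
    then obtain j where j: "i = int d * j" "0 \<le> int d * j" "int d * j < int d * int k"
      by (auto simp: dvd_def mult.commute)
    then show "i \<in> (\<lambda>j. int d * j) ` {0..<int k}"
      using d by (auto simp: zero_le_mult_iff)
  qed (use d in \<open>auto simp: mult.commute\<close>)
  moreover have "inj_on (\<lambda>j. int d * j) {0..<int k}" using d by (auto simp: inj_on_def)
  ultimately show ?thesis by (simp add: card_image)
qed

text \<open>
  The involution inverts \<open>a\<close>, so its fixed residues are those with \<open>2 i\<close> divisible by \<open>m\<close>: only
  \<open>0\<close> for odd \<open>m\<close>, and \<open>0\<close> and \<open>m div 2\<close> for even \<open>m\<close>.
\<close>
lemma ESCom_M_group:
  assumes "m > 0" "n > 0" and m: "m = d * k" "k = (if even m then 2 else 1)"
  shows "ESCom (M_group m n) \<cong>\<^sub>G complete_graph (k * n) \<or>\<^sub>G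
    (complete_graph (d * (k * n) - k * n) \<squnion>\<^sub>G graph_copies d (complete_graph (k * n)))"
proof -
  interpret twist m n "-1" 0 0 1
    using assms(1,2) by unfold_locales simp_all
  have "d > 0" using assms(1) m(1) by (cases d) auto
  have "int m dvd - 1 * i - i \<longleftrightarrow> int d dvd i" for i
  proof (cases "even m")
    case True
    then have "k = 2" using m(2) by simp
    then have "int m = 2 * int d" using m(1) by simp
    moreover have "- 1 * i - i = - (2 * i)" by simp
    ultimately show ?thesis by (simp only: dvd_minus_iff) simp
  next
    case False
    then have "k = 1" using m(2) by simp
    then have "m = d" using m(1) by simp
    moreover have "coprime (int m) 2" using False by simp
    moreover have "- 1 * i - i = - (2 * i)" by simp
    ultimately show ?thesis by (simp only: dvd_minus_iff) (simp add: coprime_dvd_mult_right_iff)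
  qed
  then have card: "card {i \<in> {0..<int m}. int m dvd - 1 * i - i \<and> int n dvd 0 * i} = k"
    using card_dvd_below[OF \<open>d > 0\<close>, of k] by (simp add: m(1) mult.commute)
  show ?thesis
    unfolding M_group_def
  proof (rule ESCom_presented_group[OF UNIV_gen _ _ _ group.M_relations_iff[OF group_H]
        group.M_relations_iff[OF group_presented_group] card m(1) HOL.refl HOL.refl])
    show "case_gen a\<^sub>H x\<^sub>H gen_a = a\<^sub>H" "case_gen a\<^sub>H x\<^sub>H gen_b = x\<^sub>H" by simp_all
    show "word_eval H (case_gen a\<^sub>H x\<^sub>H) [Pos gen_b, Pos gen_b] = c\<^sub>H"
      by (simp add: word_eval_Cons word_eval_Nil x\<^sub>H_def c\<^sub>H_def mult_H one_H)
    show "case_gen a\<^sub>H x\<^sub>H g \<in> carrier H" for g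
      using generators_in_H by (simp split: gen.split)
  qed (simp add: pres_class_in_carrier)
qed

lemma ESCom_U_group:
  assumes "n > 0"
  shows "ESCom (U_group n) \<cong>\<^sub>G
    complete_graph n \<or>\<^sub>G (complete_graph (2 * n) \<squnion>\<^sub>G graph_copies 3 (complete_graph n))"
proof -
  interpret twist 3 n "-1" 0 0 1
    using assms by unfold_locales simp_all
  have "int 3 dvd - 1 * i - i \<longleftrightarrow> int 3 dvd i" for i by presburger
  then have card: "card {i \<in> {0..<int 3}. int 3 dvd - 1 * i - i \<and> int n dvd 0 * i} = 1"
    using card_dvd_below[of 3 1] by simp
  show ?thesis
    unfolding U_group_def
  proof (rule ESCom_presented_group[OF _ _ _ _ group.U_relations_iff[OF group_H]
        group.U_relations_iff[OF group_presented_group] card])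
    show "UNIV = {gen_b, gen_a}" using UNIV_gen by blast
    show "case_gen x\<^sub>H a\<^sub>H gen_b = a\<^sub>H" "case_gen x\<^sub>H a\<^sub>H gen_a = x\<^sub>H" by simp_all
    show "word_eval H (case_gen x\<^sub>H a\<^sub>H) [Pos gen_a, Pos gen_a] = c\<^sub>H"
      by (simp add: word_eval_Cons word_eval_Nil x\<^sub>H_def c\<^sub>H_def mult_H one_H)
    show "case_gen x\<^sub>H a\<^sub>H g \<in> carrier H" for g
      using generators_in_H by (simp split: gen.split)
  qed (simp_all add: pres_class_in_carrier)
qed

lemma ESCom_dicyclic_group:
  assumes "n > 0"
  shows "ESCom (dicyclic_group n) \<cong>\<^sub>G
    complete_graph 2 \<or>\<^sub>G (complete_graph (2 * n - 2) \<squnion>\<^sub>G graph_copies n (complete_graph 2))"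
proof -
  interpret twist "2 * n" 1 "-1" 0 "int n" 0
    using assms by unfold_locales simp_all
  have "int (2 * n) dvd - 1 * i - i \<longleftrightarrow> int n dvd i" for i
  proof -
    have "- 1 * i - i = - (2 * i)" "int (2 * n) = 2 * int n" by simp_all
    then show ?thesis by (simp only: dvd_minus_iff) simp
  qed
  then have card: "card {i \<in> {0..<int (2 * n)}. int (2 * n) dvd - 1 * i - i \<and> int 1 dvd 0 * i} = 2"
    using card_dvd_below[of n 2] assms by simp
  show ?thesis
    unfolding dicyclic_group_def
  proof (rule ESCom_presented_group[OF UNIV_gen _ _ _ group.Q_relations_iff[OF group_H]
        group.Q_relations_iff[OF group_presented_group] card])
    show "case_gen a\<^sub>H x\<^sub>H gen_a = a\<^sub>H" "case_gen a\<^sub>H x\<^sub>H gen_b = x\<^sub>H" by simp_all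
    show "word_eval H (case_gen a\<^sub>H x\<^sub>H) [] = c\<^sub>H"
      by (simp add: word_eval_Nil c\<^sub>H_def one_H del: One_nat_def)
    show "case_gen a\<^sub>H x\<^sub>H g \<in> carrier H" for g
      using generators_in_H by (simp split: gen.split)
  qed (simp_all add: pres_class_in_carrier)
qed

text \<open>
  A residue \<open>i\<close> modulo \<open>4 n\<close> is fixed when \<open>2 n\<close> divides \<open>(n - 1) i\<close>. For even \<open>n\<close> the
  numbers \<open>n - 1\<close> and \<open>2 n\<close> are coprime; for odd \<open>n\<close> a factor 2 cancels on both sides, and what is left of
  \<open>n - 1\<close> is coprime to \<open>n\<close>.
\<close>
lemma ESCom_SD_group:
  assumes "n > 0" and d: "d = (if even n then 2 * n else n)" "4 * n = d * k"
  shows "ESCom (SD_group n) \<cong>\<^sub>G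
    complete_graph k \<or>\<^sub>G (complete_graph (4 * n - k) \<squnion>\<^sub>G graph_copies d (complete_graph k))"
proof -
  \<comment> \<open>multiplication by \<open>2 n - 1\<close> is an involution modulo \<open>4 n\<close>\<close>
  have sq: "(2 * int n - 1) * (2 * int n - 1) - 1 = int (4 * n) * (int n - 1)"
    by (simp add: algebra_simps)
  interpret twist "4 * n" 1 "2 * int n - 1" 0 0 0
    using assms by unfold_locales (simp_all only: sq dvd_triv_left, simp_all)
  have "int (4 * n) dvd (2 * int n - 1) * i - i \<longleftrightarrow> int d dvd i" for i
  proof -
    have i: "(2 * int n - 1) * i - i = 2 * ((int n - 1) * i)" by (simp add: algebra_simps)
    have cop: "coprime (int n) (int n - 1)"
      by simp
    have four: "int (4 * n) = 2 * (2 * int n)" by simp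
    have half: "int (4 * n) dvd (2 * int n - 1) * i - i \<longleftrightarrow> 2 * int n dvd (int n - 1) * i"
      unfolding i four dvd_mult_cancel_left by simp
    show ?thesis
    proof (cases "even n")
      case True
      then have "coprime (2 * int n) (int n - 1)" using cop by simp
      then show ?thesis
        unfolding half using True d(1) by (simp add: coprime_dvd_mult_right_iff)
    next
      case False
      then obtain e where e: "int n - 1 = 2 * e" by (metis even_of_nat evenE odd_one odd_even_add diff_add_cancel)
      have "coprime (int n) e" using cop unfolding e by simp
      moreover have "2 * int n dvd 2 * e * i \<longleftrightarrow> int n dvd e * i"
        unfolding mult.assoc dvd_mult_cancel_left by simp
      ultimately show ?thesis
        unfolding half e using False d(1) by (simp add: coprime_dvd_mult_right_iff)
    qed
  qed
  then have card: "card {i \<in> {0..<int (4 * n)}.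
      int (4 * n) dvd (2 * int n - 1) * i - i \<and> int 1 dvd 0 * i} = k"
    using card_dvd_below[of d k] assms by (simp add: mult.commute split: if_splits)
  show ?thesis
    unfolding SD_group_def
  proof (rule ESCom_presented_group[OF UNIV_gen _ _ _ group.SD_relations_iff[OF group_H]
        group.SD_relations_iff[OF group_presented_group] card d(2)])
    show "case_gen a\<^sub>H x\<^sub>H gen_a = a\<^sub>H" "case_gen a\<^sub>H x\<^sub>H gen_b = x\<^sub>H" by simp_all
    show "word_eval H (case_gen a\<^sub>H x\<^sub>H) [] = c\<^sub>H"
      by (simp add: word_eval_Nil c\<^sub>H_def one_H del: One_nat_def)
    show "case_gen a\<^sub>H x\<^sub>H g \<in> carrier H" for g
      using generators_in_H by (simp split: gen.split)
  qed (use d(2) \<open>n > 0\<close> in \<open>simp_all add: pres_class_in_carrier\<close>)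
qed

text \<open>
  A fixed residue \<open>i\<close> must satisfy \<open>n dvd i\<close>, from the \<open>a\<close>-exponent, and be even, from the
  exponent of the central factor; the parity of \<open>n\<close> decides whether the second condition is new.
\<close>
lemma ESCom_V_group:
  assumes "n > 0" and d: "d = (if even n then n else 2 * n)" "2 * n = d * k"
  shows "ESCom (V_group n) \<cong>\<^sub>G complete_graph (k * 2) \<or>\<^sub>G
    (complete_graph (4 * n - k * 2) \<squnion>\<^sub>G graph_copies d (complete_graph (k * 2)))"
proof -
  interpret twist "2 * n" 2 "-1" 1 0 1
    using assms by unfold_locales simp_all
  have "d > 0" using assms(1) d(2) by (cases d) auto
  have "k * d = 2 * n" using d(2) by (simp add: mult.commute)
  have dvd_iff: "int (2 * n) dvd - 1 * i - i \<and> int 2 dvd 1 * i \<longleftrightarrow> int d dvd i" for i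
  proof -
    have "- 1 * i - i = - (2 * i)" "int (2 * n) = 2 * int n" by simp_all
    then have "int (2 * n) dvd - 1 * i - i \<longleftrightarrow> int n dvd i" by (simp only: dvd_minus_iff) simp
    moreover have "int n dvd i \<and> 2 dvd i \<longleftrightarrow> int d dvd i"
    proof (cases "even n")
      case True
      then have "2 dvd int n" by simp
      then show ?thesis using True d(1) by (auto intro: dvd_trans)
    next
      case False
      then have "coprime 2 (int n)" by simp
      then show ?thesis
        using False d(1) divides_mult[of 2 i "int n"] by (auto intro: dvd_mult_left dvd_mult_right)
    qed
    ultimately show ?thesis by simp
  qed
  have card: "card {i \<in> {0..<int (2 * n)}. int (2 * n) dvd - 1 * i - i \<and> int 2 dvd 1 * i} = k"
    unfolding dvd_iff using card_dvd_below[OF \<open>d > 0\<close>, of k] by (simp only: \<open>k * d = 2 * n\<close>)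
  show ?thesis
    unfolding V_group_def
  proof (rule ESCom_presented_group[OF UNIV_gen _ _ _ group.V_relations_iff[OF group_H]
        group.V_relations_iff[OF group_presented_group] card d(2)])
    show "case_gen a\<^sub>H x\<^sub>H gen_a = a\<^sub>H" "case_gen a\<^sub>H x\<^sub>H gen_b = x\<^sub>H" by simp_all
    show "word_eval H (case_gen a\<^sub>H x\<^sub>H) [Pos gen_b, Pos gen_b] = c\<^sub>H"
      by (simp add: word_eval_Cons word_eval_Nil x\<^sub>H_def c\<^sub>H_def mult_H one_H)
    show "case_gen a\<^sub>H x\<^sub>H g \<in> carrier H" for g
      using generators_in_H by (simp split: gen.split)
  qed (use d(2) in \<open>simp_all add: pres_class_in_carrier\<close>)
qed

lemma dihedral_group_eq_M_group: "dihedral_group n = M_group n 1"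
  by (simp add: dihedral_group_def M_group_def)

lemma quasidihedral_group_eq_SD_group:
  assumes "n \<ge> 3"
  shows "quasidihedral_group n = SD_group (2 ^ (n - 3))"
proof -
  obtain j where "n = j + 3" using assms le_Suc_ex by (metis add.commute)
  then show ?thesis by (simp add: quasidihedral_group_def SD_group_def)
qed

lemma ESCom_swap_union:
  assumes "ESCom G \<cong>\<^sub>G complete_graph a \<or>\<^sub>G (complete_graph b \<squnion>\<^sub>G graph_copies s (complete_graph k))"
  shows "ESCom G \<cong>\<^sub>G complete_graph a \<or>\<^sub>G (graph_copies s (complete_graph k) \<squnion>\<^sub>G complete_graph b)"
  by (rule graph_iso_trans[OF _ _ _ assms graph_join_union_commute]) (intro pair_wf_intros)+

theorem proposition2p1:
  shows
    "(\<forall>n::nat. n \<ge> 3 \<longrightarrow>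
        (odd n \<longrightarrow> ESCom (dihedral_group n) \<cong>\<^sub>G
           complete_graph 1 \<or>\<^sub>G (graph_copies n (complete_graph 1) \<squnion>\<^sub>G complete_graph (n - 1))) \<and>
        (even n \<longrightarrow> ESCom (dihedral_group n) \<cong>\<^sub>G
           complete_graph 2 \<or>\<^sub>G (graph_copies (n div 2) (complete_graph 2) \<squnion>\<^sub>G complete_graph (n - 2)))) \<and>
     (\<forall>n::nat. n \<ge> 2 \<longrightarrow>
        ESCom (dicyclic_group n) \<cong>\<^sub>G
           complete_graph 2 \<or>\<^sub>G (graph_copies n (complete_graph 2) \<squnion>\<^sub>G complete_graph (2 * n - 2))) \<and>
     (\<forall>n::nat. n \<ge> 4 \<longrightarrow>
        ESCom (quasidihedral_group n) \<cong>\<^sub>G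
           complete_graph 2 \<or>\<^sub>G (complete_graph (2 ^ (n - 1) - 2) \<squnion>\<^sub>G graph_copies (2 ^ (n - 2)) (complete_graph 2))) \<and>
     (\<forall>n::nat. n \<ge> 1 \<longrightarrow>
        (odd n \<longrightarrow> ESCom (V_group n) \<cong>\<^sub>G
           complete_graph 2 \<or>\<^sub>G (complete_graph (4 * n - 2) \<squnion>\<^sub>G graph_copies (2 * n) (complete_graph 2))) \<and>
        (even n \<longrightarrow> ESCom (V_group n) \<cong>\<^sub>G
           complete_graph 4 \<or>\<^sub>G (complete_graph (4 * n - 4) \<squnion>\<^sub>G graph_copies n (complete_graph 4)))) \<and>
     (\<forall>n::nat. n \<ge> 2 \<longrightarrow>
        (odd n \<longrightarrow> ESCom (SD_group n) \<cong>\<^sub>G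
           complete_graph 4 \<or>\<^sub>G (complete_graph (4 * n - 4) \<squnion>\<^sub>G graph_copies n (complete_graph 4))) \<and>
        (even n \<longrightarrow> ESCom (SD_group n) \<cong>\<^sub>G
           complete_graph 2 \<or>\<^sub>G (complete_graph (4 * n - 2) \<squnion>\<^sub>G graph_copies (2 * n) (complete_graph 2)))) \<and>
     (\<forall>n::nat. n \<ge> 1 \<longrightarrow>
        ESCom (U_group n) \<cong>\<^sub>G
           complete_graph n \<or>\<^sub>G (complete_graph (2 * n) \<squnion>\<^sub>G graph_copies 3 (complete_graph n))) \<and>
     (\<forall>(m::nat) (n::nat). m \<ge> 3 \<and> m \<noteq> 4 \<and> n \<ge> 1 \<longrightarrow>
        (odd m \<longrightarrow> ESCom (M_group m n) \<cong>\<^sub>G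
           complete_graph n \<or>\<^sub>G (complete_graph ((m - 1) * n) \<squnion>\<^sub>G graph_copies m (complete_graph n))) \<and>
        (even m \<longrightarrow> ESCom (M_group m n) \<cong>\<^sub>G
           complete_graph (2 * n) \<or>\<^sub>G
             (complete_graph ((m div 2 - 1) * (2 * n)) \<squnion>\<^sub>G graph_copies (m div 2) (complete_graph (2 * n)))))"
proof (intro conjI allI impI)
  fix n :: nat assume n: "n \<ge> 3" "odd n"
  have "ESCom (M_group n 1) \<cong>\<^sub>G
    complete_graph 1 \<or>\<^sub>G (complete_graph (n - 1) \<squnion>\<^sub>G graph_copies n (complete_graph 1))"
    using ESCom_M_group[of n 1 n 1] n by simp
  then show "ESCom (dihedral_group n) \<cong>\<^sub>G
    complete_graph 1 \<or>\<^sub>G (graph_copies n (complete_graph 1) \<squnion>\<^sub>G complete_graph (n - 1))"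
    unfolding dihedral_group_eq_M_group by (rule ESCom_swap_union)
next
  fix n :: nat assume n: "n \<ge> 3" "even n"
  have "ESCom (M_group n 1) \<cong>\<^sub>G
    complete_graph 2 \<or>\<^sub>G (complete_graph (n - 2) \<squnion>\<^sub>G graph_copies (n div 2) (complete_graph 2))"
    using ESCom_M_group[of n 1 "n div 2" 2] n by simp
  then show "ESCom (dihedral_group n) \<cong>\<^sub>G
    complete_graph 2 \<or>\<^sub>G (graph_copies (n div 2) (complete_graph 2) \<squnion>\<^sub>G complete_graph (n - 2))"
    unfolding dihedral_group_eq_M_group by (rule ESCom_swap_union)
next
  fix n :: nat assume "n \<ge> 2"
  then show "ESCom (dicyclic_group n) \<cong>\<^sub>G
    complete_graph 2 \<or>\<^sub>G (graph_copies n (complete_graph 2) \<squnion>\<^sub>G complete_graph (2 * n - 2))"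
    by (intro ESCom_swap_union ESCom_dicyclic_group) simp
next
  fix n :: nat assume n: "n \<ge> 4"
  then have even: "even ((2::nat) ^ (n - 3))" by simp
  obtain j where "n = j + 3" using n le_Suc_ex[of 3 n] by (auto simp: add.commute)
  then have pow: "4 * 2 ^ (n - 3) = (2::nat) ^ (n - 1)" "2 * 2 ^ (n - 3) = (2::nat) ^ (n - 2)"
    by simp_all
  have "ESCom (SD_group (2 ^ (n - 3))) \<cong>\<^sub>G complete_graph 2 \<or>\<^sub>G
    (complete_graph (4 * 2 ^ (n - 3) - 2) \<squnion>\<^sub>G graph_copies (2 * 2 ^ (n - 3)) (complete_graph 2))"
    using even by (intro ESCom_SD_group) simp_all
  then show "ESCom (quasidihedral_group n) \<cong>\<^sub>G complete_graph 2 \<or>\<^sub>G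
    (complete_graph (2 ^ (n - 1) - 2) \<squnion>\<^sub>G graph_copies (2 ^ (n - 2)) (complete_graph 2))"
    using n unfolding pow by (simp only: quasidihedral_group_eq_SD_group)
next
  fix n :: nat assume "n \<ge> 1" "odd n"
  then show "ESCom (V_group n) \<cong>\<^sub>G
    complete_graph 2 \<or>\<^sub>G (complete_graph (4 * n - 2) \<squnion>\<^sub>G graph_copies (2 * n) (complete_graph 2))"
    using ESCom_V_group[of n "2 * n" 1] by simp
next
  fix n :: nat assume "n \<ge> 1" "even n"
  then show "ESCom (V_group n) \<cong>\<^sub>G
    complete_graph 4 \<or>\<^sub>G (complete_graph (4 * n - 4) \<squnion>\<^sub>G graph_copies n (complete_graph 4))"
    using ESCom_V_group[of n n 2] by simp
next
  fix n :: nat assume "n \<ge> 2" "odd n"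
  then show "ESCom (SD_group n) \<cong>\<^sub>G
    complete_graph 4 \<or>\<^sub>G (complete_graph (4 * n - 4) \<squnion>\<^sub>G graph_copies n (complete_graph 4))"
    by (intro ESCom_SD_group) simp_all
next
  fix n :: nat assume "n \<ge> 2" "even n"
  then show "ESCom (SD_group n) \<cong>\<^sub>G
    complete_graph 2 \<or>\<^sub>G (complete_graph (4 * n - 2) \<squnion>\<^sub>G graph_copies (2 * n) (complete_graph 2))"
    by (intro ESCom_SD_group) simp_all
next
  fix n :: nat assume "n \<ge> 1"
  then show "ESCom (U_group n) \<cong>\<^sub>G
    complete_graph n \<or>\<^sub>G (complete_graph (2 * n) \<squnion>\<^sub>G graph_copies 3 (complete_graph n))"
    by (intro ESCom_U_group) simp
next
  fix m n :: nat assume mn: "m \<ge> 3 \<and> m \<noteq> 4 \<and> n \<ge> 1" "odd m"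
  have "m * n - n = (m - 1) * n" by (simp add: diff_mult_distrib)
  then show "ESCom (M_group m n) \<cong>\<^sub>G
    complete_graph n \<or>\<^sub>G (complete_graph ((m - 1) * n) \<squnion>\<^sub>G graph_copies m (complete_graph n))"
    using ESCom_M_group[of m n m 1] mn by simp
next
  fix m n :: nat assume mn: "m \<ge> 3 \<and> m \<noteq> 4 \<and> n \<ge> 1" "even m"
  have "m div 2 * (2 * n) - 2 * n = (m div 2 - 1) * (2 * n)" by (simp add: diff_mult_distrib)
  then show "ESCom (M_group m n) \<cong>\<^sub>G complete_graph (2 * n) \<or>\<^sub>G
    (complete_graph ((m div 2 - 1) * (2 * n)) \<squnion>\<^sub>G graph_copies (m div 2) (complete_graph (2 * n)))"
    using ESCom_M_group[of m n "m div 2" 2] mn by (simp only:) simp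
qed

end
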